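(* Let $A$ be a unital semi-simple commutative Banach algebra, $U$ an automorphism of $A$, and $w \in A$. Let $T = wU$ and let $\check{T}$ be the associated weighted composition operator on $\check{A}$. Assume that (a) $w$ is an invertible element of $A$, and (b) $\sigma(\check{T}) = \mathbb{T} \subseteq \sigma(T)$. Then the set $\sigma(T)$ is connected.
   Context: $A$ is a unital commutative semi-simple Banach algebra with maximal ideal space $\mathfrak{M}_A$ and Shilov boundary $\partial A$. For $f\in A$, $\check f$ is the restriction of the Gelfand transform $\hat f$ to $\partial A$; $\check A$ is the closure of $\{\check f: f\in A\}$ in $C(\partial A)$ with sup norm. The automorphism $U$ induces a homeomorphism $\varphi$ of $\mathfrak{M}_A$ by $\widehat{Uf}(m)=\hat f(\varphi(m))$, with $\varphi(\partial A)=\partial A$. $T=wU$ means $Tf=w\cdot Uf$; $\check T$ is the operator on $\check A$ given by $(\check Tg)(t)=\check w(t)g(\varphi(t))$, $t\in\partial A$. $\mathbb{T}$ is the unit circle. *)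

theory Defs
  imports "HOL-Analysis.Analysis"
begin

text \<open>A complex unital commutative Banach algebra is modelled as a type
  'a of class real_normed_algebra_1, comm_ring_1, banach together with an element j
  with j * j = -1 inducing the complex scalar multiplication, with the norm
  homogeneous for complex scalars.\<close>

definition cscale :: "'a::real_normed_algebra_1 \<Rightarrow> complex \<Rightarrow> 'a \<Rightarrow> 'a" where
  "cscale j c x = (of_real (Re c) + of_real (Im c) * j) * x"

definition complex_structure :: "'a::{real_normed_algebra_1,comm_ring_1,banach} \<Rightarrow> bool" where
  "complex_structure j \<longleftrightarrow> j * j = -1 \<and> (\<forall>c x. norm (cscale j c x) = cmod c * norm x)"

definition is_ideal :: "'a::comm_ring_1 set \<Rightarrow> bool" where
  "is_ideal I \<longleftrightarrow> 0 \<in> I \<and> (\<forall>x\<in>I. \<forall>y\<in>I. x + y \<in> I) \<and> (\<forall>a. \<forall>x\<in>I. a * x \<in> I)"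

definition maximal_ideal :: "'a::comm_ring_1 set \<Rightarrow> bool" where
  "maximal_ideal I \<longleftrightarrow> is_ideal I \<and> I \<noteq> UNIV \<and>
     (\<forall>J. is_ideal J \<and> I \<subseteq> J \<and> J \<noteq> UNIV \<longrightarrow> J = I)"

definition semisimple :: "'a::comm_ring_1 itself \<Rightarrow> bool" where
  "semisimple _ \<longleftrightarrow> \<Inter>{I::'a set. maximal_ideal I} = {0}"

text \<open>Maximal ideal space: nonzero complex-linear multiplicative functionals, with the
  Gelfand (weak-star) topology = topology of pointwise convergence, i.e. the subspace
  topology of the product topology on 'a => complex.  The Gelfand transform of f is
  (\<lambda>m. m f).\<close>

definition max_ideal_space :: "'a::{real_normed_algebra_1,comm_ring_1,banach} \<Rightarrow> ('a \<Rightarrow> complex) set" where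
  "max_ideal_space j = {m. (\<forall>x y. m (x + y) = m x + m y) \<and> (\<forall>x y. m (x * y) = m x * m y) \<and>
      (\<forall>c x. m (cscale j c x) = c * m x) \<and> m 1 = 1}"

definition is_boundary :: "'a::{real_normed_algebra_1,comm_ring_1,banach} \<Rightarrow> ('a \<Rightarrow> complex) set \<Rightarrow> bool" where
  "is_boundary j B \<longleftrightarrow> B \<subseteq> max_ideal_space j \<and>
     (\<forall>f. \<exists>m\<in>B. \<forall>m'\<in>max_ideal_space j. cmod (m' f) \<le> cmod (m f))"

definition shilov_boundary :: "'a::{real_normed_algebra_1,comm_ring_1,banach} \<Rightarrow> ('a \<Rightarrow> complex) set" where
  "shilov_boundary j = \<Inter>{B. is_boundary j B \<and> closedin (top_of_set (max_ideal_space j)) B}"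

text \<open>Elements of the uniform closure A-check of the restricted Gelfand transforms,
  represented as functions on the Shilov boundary (extended by 0 outside it).\<close>

definition check_alg :: "'a::{real_normed_algebra_1,comm_ring_1,banach} \<Rightarrow> (('a \<Rightarrow> complex) \<Rightarrow> complex) set" where
  "check_alg j = {g. (\<forall>t. t \<notin> shilov_boundary j \<longrightarrow> g t = 0) \<and>
      (\<forall>\<epsilon>>0. \<exists>f. \<forall>t\<in>shilov_boundary j. cmod (g t - t f) < \<epsilon>)}"

definition check_op :: "'a::{real_normed_algebra_1,comm_ring_1,banach} \<Rightarrow> 'a \<Rightarrow> ('a \<Rightarrow> 'a)
     \<Rightarrow> (('a \<Rightarrow> complex) \<Rightarrow> complex) \<Rightarrow> (('a \<Rightarrow> complex) \<Rightarrow> complex)" where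
  "check_op j w U g = (\<lambda>t. if t \<in> shilov_boundary j then t w * g (t \<circ> U) else 0)"

definition op_spectrum :: "'a::{real_normed_algebra_1,comm_ring_1,banach} \<Rightarrow> ('a \<Rightarrow> 'a) \<Rightarrow> complex set" where
  "op_spectrum j T = {lam. \<not> (\<exists>S. (\<forall>x. S (T x - cscale j lam x) = x) \<and>
      (\<forall>x. T (S x) - cscale j lam (S x) = x) \<and> (\<exists>K. \<forall>x. norm (S x) \<le> K * norm x))}"

definition check_spectrum :: "'a::{real_normed_algebra_1,comm_ring_1,banach} \<Rightarrow>
    ((('a \<Rightarrow> complex) \<Rightarrow> complex) \<Rightarrow> (('a \<Rightarrow> complex) \<Rightarrow> complex)) \<Rightarrow> complex set" where
  "check_spectrum j Tc = (let C = check_alg j; D = shilov_boundary j in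
     {lam. \<not> (\<exists>S. (\<forall>g\<in>C. S g \<in> C) \<and>
        (\<forall>g\<in>C. S (\<lambda>t. Tc g t - lam * g t) = g) \<and>
        (\<forall>g\<in>C. (\<lambda>t. Tc (S g) t - lam * S g t) = g) \<and>
        (\<exists>K. \<forall>g\<in>C. (SUP t\<in>D. cmod (S g t)) \<le> K * (SUP t\<in>D. cmod (g t))))})"

definition algebra_automorphism :: "'a::{real_normed_algebra_1,comm_ring_1,banach} \<Rightarrow> ('a \<Rightarrow> 'a) \<Rightarrow> bool" where
  "algebra_automorphism j U \<longleftrightarrow> bij U \<and> (\<forall>x y. U (x + y) = U x + U y) \<and>
     (\<forall>x y. U (x * y) = U x * U y) \<and> (\<forall>c x. U (cscale j c x) = cscale j c (U x)) \<and> U 1 = 1"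

end

theory Submission
  imports Defs "HOL-Complex_Analysis.Complex_Analysis"
begin

text \<open>
  Let \<open>S\<^sub>c\<close> be the resolvent of the operator that \<open>T\<close> induces on the closure of the restrictions to
  the Shilov boundary. A loop in the resolvent set of \<open>T\<close> that stays inside the open unit disc can
  only wind around points \<open>z\<close> of the resolvent set: the Cauchy integral of \<open>(T - c)\<inverse> f\<close> along
  the loop is an element of the algebra; for \<open>t\<close> in the Shilov boundary, \<open>c \<mapsto> S\<^sub>c f t\<close> is
  holomorphic on the whole disc, so the integral restricts to a multiple of \<open>S\<^sub>z f\<close>; and as the
  restriction map is injective, it solves \<open>(T - z) g = f\<close> up to a factor. Hence all components of
  the resolvent set within the disc are simply connected, and therefore the union of the spectrum
  with the exterior of the disc is connected. Projecting the exterior onto the circle, which belongs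
  to the spectrum, shows that the part of the spectrum in the closed disc is connected. The same
  argument for the pencil \<open>1 - c T\<close> in place of \<open>T - c\<close> deals with the part outside the open disc,
  and the two parts meet in the circle.
\<close>

section \<open>Plane topology\<close>

lemma polynomial_loop_same_winding_number:
  assumes "open S" "path g" "pathfinish g = pathstart g" "path_image g \<subseteq> S" "z \<notin> path_image g"
  obtains p where "polynomial_function p" "pathfinish p = pathstart p" "path_image p \<subseteq> S"
    "z \<notin> path_image p" "winding_number p z = winding_number g z"
proof -
  define K where "K = - S \<union> {z}"
  have "closed K" "path_image g \<inter> K = {}"
    using assms by (auto simp: K_def closed_Compl)
  then obtain e where separation: "e > 0" "\<And>x y. x \<in> path_image g \<Longrightarrow> y \<in> K \<Longrightarrow> e \<le> dist x y"
    using separate_compact_closed[OF compact_path_image[OF \<open>path g\<close>], of K] by blast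
  obtain p where p_approx: "polynomial_function p"
    "pathstart p = pathstart g" "pathfinish p = pathfinish g"
    "\<And>t. t \<in> {0..1} \<Longrightarrow> norm (p t - g t) < e"
    using path_approx_polynomial_function[OF \<open>path g\<close> \<open>e > 0\<close>] by metis
  have "p t \<notin> K" if "t \<in> {0..1}" for t
    using p_approx(4)[OF that] separation(2)[of "g t" "p t"] that
    by (auto simp: path_image_def dist_norm norm_minus_commute)
  then have "path_image p \<subseteq> S" "z \<notin> path_image p"
    by (force simp: path_image_def K_def)+
  moreover have "winding_number p z = winding_number g z"
  proof (rule winding_number_nearby_paths_eq)
    show "path p"
      using p_approx(1) by (rule path_polynomial_function)
    show "norm (p t - g t) < norm (g t - z)" if "t \<in> {0..1}" for t
      using p_approx(4)[OF that] separation(2)[of "g t" z] that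
      by (auto simp: path_image_def K_def dist_norm)
  qed (use assms p_approx in auto)
  ultimately show ?thesis
    using that p_approx assms(3) by metis
qed

lemma connected_path_image_Un_component:
  fixes g :: "real \<Rightarrow> 'a::euclidean_space"
  assumes "path g"
  shows "connected (path_image g \<union> connected_component_set (- path_image g) z)"
proof (rule connected_Un_clopen_in_complement[of _ UNIV])
  have "open (- path_image g)"
    using assms by (simp add: closed_path_image open_Compl)
  then show "openin (top_of_set (UNIV - path_image g)) (connected_component_set (- path_image g) z)"
    by (simp add: open_subset connected_component_subset open_connected_component
        flip: Compl_eq_Diff_UNIV)
qed (use assms in \<open>auto simp: connected_path_image closedin_connected_component
    simp flip: Compl_eq_Diff_UNIV\<close>)

lemma winding_number_eq_on_component:
  assumes "path g" "pathfinish g = pathstart g" "y \<in> connected_component_set (- path_image g) z"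
  shows "winding_number g y = winding_number g z"
proof -
  let ?Z = "connected_component_set (- path_image g) z"
  have "winding_number g constant_on ?Z"
    using assms connected_component_subset by (intro winding_number_constant) auto
  moreover have "z \<in> ?Z"
    using assms(3)
    by (metis connected_component_eq_empty connected_component_refl_eq empty_iff mem_Collect_eq)
  ultimately show ?thesis
    using assms(3) unfolding constant_on_def by metis
qed

lemma component_subset_if_loops_filled:
  fixes S :: "complex set"
  assumes "open S"
    and filled: "\<And>p z. \<lbrakk>polynomial_function p; pathfinish p = pathstart p; path_image p \<subseteq> S;
      z \<notin> path_image p; winding_number p z \<noteq> 0\<rbrakk> \<Longrightarrow> z \<in> S"
    and loop: "path g" "pathfinish g = pathstart g" "path_image g \<subseteq> S" "winding_number g z \<noteq> 0"
  shows "connected_component_set (- path_image g) z \<subseteq> S"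
proof
  fix y assume y_in_component: "y \<in> connected_component_set (- path_image g) z"
  then have "y \<notin> path_image g"
    using connected_component_subset by blast
  moreover have "winding_number g y \<noteq> 0"
    using winding_number_eq_on_component[OF loop(1,2) y_in_component] loop(4) by simp
  ultimately show "y \<in> S"
    using polynomial_loop_same_winding_number[OF \<open>open S\<close> loop(1-3)] filled by metis
qed

proposition connected_Compl_if_loops_filled:
  fixes S :: "complex set"
  assumes "open S" "bounded S"
    and filled: "\<And>p z. \<lbrakk>polynomial_function p; pathfinish p = pathstart p; path_image p \<subseteq> S;
      z \<notin> path_image p; winding_number p z \<noteq> 0\<rbrakk> \<Longrightarrow> z \<in> S"
  shows "connected (- S)"
proof -
  have "simply_connected C" if component: "C \<in> components S" for C
  proof -
    have "winding_number g z = 0"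
      if loop: "path g" "path_image g \<subseteq> C" "pathfinish g = pathstart g" and "z \<notin> C" for g z
    proof (rule ccontr)
      assume nonzero: "winding_number g z \<noteq> 0"
      let ?Z = "connected_component_set (- path_image g) z"
      have "path_image g \<subseteq> S"
        using loop(2) in_components_subset[OF component] by blast
      moreover have "?Z \<subseteq> S"
        by (rule component_subset_if_loops_filled[OF \<open>open S\<close> _ loop(1,3) \<open>path_image g \<subseteq> S\<close> nonzero])
          (rule filled)
      ultimately have "path_image g \<union> ?Z \<subseteq> S"
        by blast
      moreover have "connected (path_image g \<union> ?Z)"
        by (rule connected_path_image_Un_component[OF loop(1)])
      moreover have "C \<inter> (path_image g \<union> ?Z) \<noteq> {}"
        using loop(2) path_image_nonempty[of g] by blast
      ultimately have "path_image g \<union> ?Z \<subseteq> C"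
        using components_maximal[OF component] by blast
      moreover have "z \<in> ?Z"
        using loop(2) \<open>z \<notin> C\<close> by auto
      ultimately show False
        using \<open>z \<notin> C\<close> by blast
    qed
    then show ?thesis
      using simply_connected_eq_winding_number_zero[OF open_components[OF \<open>open S\<close> component]]
        in_components_connected[OF component] by blast
  qed
  then show ?thesis
    using Borsukian_eq_simply_connected[OF \<open>open S\<close>] Borsukian_separation_open_closed[of S] assms
    by blast
qed

text \<open>The projection onto \<open>S\<close> maps the outside of \<open>S\<close> to the frontier.\<close>

lemma connected_Int_closed_convex_if_connected_Un:
  fixes K S :: "'a::euclidean_space set"
  assumes "convex S" "closed S" "interior S \<noteq> {}" "frontier S \<subseteq> K"
    and "connected (K \<union> - interior S)"
  shows "connected (K \<inter> S)"
proof -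
  have nonempty: "S \<noteq> {}"
    using assms interior_subset by blast
  have outside: "closest_point S x \<in> frontier S" if "x \<notin> S" for x
    using closest_point_in_rel_interior[OF \<open>closed S\<close> nonempty, of x]
      closest_point_in_set[OF \<open>closed S\<close> nonempty, of x]
      that affine_hull_nonempty_interior[OF assms(3)] rel_interior_nonempty_interior[OF assms(3)]
      interior_subset
    by (auto simp: frontier_def \<open>closed S\<close>)
  have "closest_point S x \<in> K" if "x \<in> K \<union> - interior S" for x
  proof (cases "x \<in> S")
    case True
    then show ?thesis
      using that assms(2,4) by (auto simp: closest_point_self frontier_def)
  next
    case False
    then show ?thesis
      using outside assms(4) by blast
  qed
  then have "closest_point S ` (K \<union> - interior S) \<subseteq> K \<inter> S"
    using closest_point_in_set[OF \<open>closed S\<close> nonempty] by blast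
  moreover have "K \<inter> S \<subseteq> closest_point S ` (K \<union> - interior S)"
    using closest_point_self[of _ S] by (metis IntE Un_iff image_eqI subsetI)
  moreover have "connected (closest_point S ` (K \<union> - interior S))"
    using assms nonempty by (intro connected_continuous_image continuous_on_closest_point)
  ultimately show ?thesis
    by (metis subset_antisym)
qed

lemma connected_if_connected_Un_Compl_disc:
  fixes K :: "complex set"
  assumes "sphere 0 1 \<subseteq> K"
    and "connected (K \<union> - ball 0 1)"
    and "connected ({c. c \<noteq> 0 \<and> inverse c \<in> K} \<union> - ball 0 1)" (is "connected (?L \<union> _)")
  shows "connected K"
proof -
  have "connected (K \<inter> cball 0 1)"
    using assms(1,2) by (intro connected_Int_closed_convex_if_connected_Un) auto
  moreover have "connected (K - ball 0 1)"
  proof -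
    have "sphere 0 1 \<subseteq> ?L"
      using assms(1) by (fastforce simp: norm_inverse)
    then have "connected (?L \<inter> cball 0 1)"
      using assms(3) by (intro connected_Int_closed_convex_if_connected_Un) auto
    moreover have "inverse ` (?L \<inter> cball 0 1) = K - ball 0 1"
    proof
      show "inverse ` (?L \<inter> cball 0 1) \<subseteq> K - ball 0 1"
        by (auto simp: norm_inverse inverse_less_1_iff)
      show "K - ball 0 1 \<subseteq> inverse ` (?L \<inter> cball 0 1)"
      proof
        fix c assume "c \<in> K - ball 0 1"
        then show "c \<in> inverse ` (?L \<inter> cball 0 1)"
          by (intro image_eqI[of _ _ "inverse c"]) (auto simp: norm_inverse inverse_le_1_iff)
      qed
    qed
    moreover have "continuous_on (?L \<inter> cball 0 1) inverse"
      by (intro continuous_intros) auto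
    ultimately show ?thesis
      by (metis connected_continuous_image)
  qed
  moreover have "1 \<in> (K \<inter> cball 0 1) \<inter> (K - ball 0 1)"
    using assms(1) by auto
  moreover have "K = (K \<inter> cball 0 1) \<union> (K - ball 0 1)"
    by auto
  ultimately show ?thesis
    by (metis connected_Un empty_iff)
qed

section \<open>Bounded linear operators on Banach spaces\<close>

lemma ex_interior_closure_sublevel:
  fixes F :: "'a::banach \<Rightarrow> 'b::real_normed_vector"
  shows "\<exists>n::nat. interior (closure {x. norm (F x) \<le> n}) \<noteq> {}"
proof (rule ccontr)
  let ?A = "\<lambda>n::nat. closure {x. norm (F x) \<le> n}"
  assume "\<not> ?thesis"
  then have "euclidean interior_of (\<Union>n. ?A n) = {}"
    by (intro Baire_category_alt) (auto simp: completely_metrizable_space_euclidean)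
  moreover have "(\<Union>n. ?A n) = UNIV"
  proof -
    have "x \<in> ?A (nat \<lceil>norm (F x)\<rceil>)" for x
      by (rule subsetD[OF closure_subset]) simp
    then show ?thesis by blast
  qed
  ultimately show False by simp
qed

lemma linear_approx_if_ball_subset_closure_sublevel:
  fixes F :: "'a::real_normed_vector \<Rightarrow> 'b::real_normed_vector"
  assumes "linear F" and ball_subset: "r > 0" "ball x0 r \<subseteq> closure {x. norm (F x) \<le> b}"
  shows "\<exists>y. norm (x - y) \<le> norm x / 2 \<and> norm (F y) \<le> 4 * b / r * norm x"
proof (cases "x = 0")
  case True
  then show ?thesis
    using linear_0[OF \<open>linear F\<close>] by (intro exI[of _ 0]) simp
next
  case False
  interpret linear F by fact
  define s where "s = r / (2 * norm x)"
  have s_pos: "s > 0"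
    using False ball_subset by (simp add: s_def)
  have "x0 + s *\<^sub>R x \<in> ball x0 r" "x0 \<in> ball x0 r" "r / 8 > 0"
    using ball_subset False by (auto simp: dist_norm s_def)
  then obtain u v where u_near: "norm (F u) \<le> b" "dist u (x0 + s *\<^sub>R x) < r / 8"
      and v_near: "norm (F v) \<le> b" "dist v x0 < r / 8"
    using ball_subset(2) unfolding subset_iff closure_approachable by blast
  define y where "y = (1 / s) *\<^sub>R (u - v)"
  have "x - y = (1 / s) *\<^sub>R ((x0 + s *\<^sub>R x - u) - (x0 - v))"
    using s_pos by (simp add: y_def algebra_simps)
  then have "norm (x - y) = (1 / s) * norm ((x0 + s *\<^sub>R x - u) - (x0 - v))"
    using s_pos by simp
  also have "\<dots> \<le> (1 / s) * (r / 8 + r / 8)"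
    using u_near v_near s_pos norm_triangle_ineq4[of "x0 + s *\<^sub>R x - u" "x0 - v"]
    by (intro mult_left_mono) (auto simp: dist_norm norm_minus_commute)
  also have "\<dots> = norm x / 2"
    using ball_subset by (simp add: s_def)
  finally have "norm (x - y) \<le> norm x / 2" .
  moreover have "norm (F y) \<le> 4 * b / r * norm x"
  proof -
    have "norm (F y) = (1 / s) * norm (F u - F v)"
      using s_pos by (simp add: y_def scale diff)
    also have "\<dots> \<le> (1 / s) * (b + b)"
      using u_near v_near s_pos norm_triangle_ineq4[of "F u" "F v"] by (intro mult_left_mono) auto
    finally show ?thesis
      using ball_subset by (simp add: s_def field_simps)
  qed
  ultimately show ?thesis by blast
qed

lemma linear_nearly_bounded:
  fixes F :: "'a::banach \<Rightarrow> 'b::real_normed_vector"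
  assumes "linear F"
  obtains K where "K \<ge> 0" "\<And>x. \<exists>y. norm (x - y) \<le> norm x / 2 \<and> norm (F y) \<le> K * norm x"
proof -
  obtain n :: nat where "interior (closure {x. norm (F x) \<le> n}) \<noteq> {}"
    using ex_interior_closure_sublevel by blast
  then obtain x0 r where "r > 0" "ball x0 r \<subseteq> closure {x. norm (F x) \<le> n}"
    by (auto simp: interior_def open_contains_ball) (metis subset_trans)
  then show ?thesis
    using linear_approx_if_ball_subset_closure_sublevel[OF assms] by (intro that[of "4 * n / r"]) auto
qed

lemma ex_expansion_if_nearly_bounded:
  fixes F :: "'a::real_normed_vector \<Rightarrow> 'b::real_normed_vector"
  assumes "K \<ge> 0" "\<And>x. \<exists>y. norm (x - y) \<le> norm x / 2 \<and> norm (F y) \<le> K * norm x"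
  obtains Y where "Y sums x" "\<And>k. norm (F (Y k)) \<le> K * norm x * (1 / 2) ^ k"
proof -
  obtain g where halving: "\<And>x. norm (x - g x) \<le> norm x / 2" "\<And>x. norm (F (g x)) \<le> K * norm x"
    using assms(2) by metis
  define X where "X k = ((\<lambda>u. u - g u) ^^ k) x" for k
  have X_Suc: "X (Suc k) = X k - g (X k)" for k
    by (simp add: X_def)
  have X_bound: "norm (X k) \<le> norm x * (1 / 2) ^ k" for k
  proof (induction k)
    case (Suc k)
    then show ?case
      using halving(1)[of "X k"] by (simp add: X_Suc)
  qed (simp add: X_def)
  have "(\<lambda>k. norm x * (1 / 2) ^ k) \<longlonglongrightarrow> norm x * 0"
    by (intro tendsto_intros LIMSEQ_power_zero) simp
  then have "X \<longlonglongrightarrow> 0"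
    by (intro Lim_null_comparison[where f = X and g = "\<lambda>k. norm x * (1 / 2) ^ k"])
      (simp_all add: X_bound)
  moreover have "(\<Sum>i<k. g (X i)) = x - X k" for k
    by (induction k) (simp add: X_def, simp add: X_Suc)
  ultimately have "(\<lambda>k. g (X k)) sums x"
    using tendsto_diff[of "\<lambda>_. x" x sequentially X 0] by (simp add: sums_def)
  moreover have "norm (F (g (X k))) \<le> K * norm x * (1 / 2) ^ k" for k
    using order_trans[OF halving(2) mult_left_mono[OF X_bound \<open>K \<ge> 0\<close>], of k] by (simp add: mult.assoc)
  ultimately show thesis
    by (rule that)
qed

theorem closed_graph_bounded_linear:
  fixes F :: "'a::banach \<Rightarrow> 'b::banach"
  assumes "linear F"
    and closed_graph: "\<And>X x y. \<lbrakk>X \<longlonglongrightarrow> x; (\<lambda>n. F (X n)) \<longlonglongrightarrow> y\<rbrakk> \<Longrightarrow> F x = y"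
  shows "bounded_linear F"
proof -
  interpret linear F by fact
  obtain K where nearly_bounded: "K \<ge> 0" "\<And>x. \<exists>y. norm (x - y) \<le> norm x / 2 \<and> norm (F y) \<le> K * norm x"
    using linear_nearly_bounded[OF \<open>linear F\<close>] by blast
  have "norm (F x) \<le> norm x * (2 * K)" for x
  proof -
    obtain Y where expansion: "Y sums x" "\<And>k. norm (F (Y k)) \<le> K * norm x * (1 / 2) ^ k"
      using ex_expansion_if_nearly_bounded[OF nearly_bounded] by blast
    have geometric: "(\<lambda>k. K * norm x * (1 / 2) ^ k) sums (K * norm x * 2)"
      using sums_mult[OF geometric_sums[of "1 / 2 :: real"], of "K * norm x"] by simp
    have summable: "summable (\<lambda>k. norm (F (Y k)))"
      by (rule summable_comparison_test'[OF sums_summable[OF geometric]]) (use expansion(2) in auto)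
    have "F x = (\<Sum>k. F (Y k))"
      using summable_LIMSEQ[OF summable_norm_cancel[OF summable]]
      by (intro closed_graph[OF expansion(1)[unfolded sums_def]]) (simp add: sum)
    also have "norm \<dots> \<le> (\<Sum>k. norm (F (Y k)))"
      by (rule summable_norm[OF summable])
    also have "\<dots> \<le> K * norm x * 2"
      using suminf_le[OF expansion(2) summable sums_summable[OF geometric]] sums_unique[OF geometric]
      by simp
    finally show ?thesis
      by (simp add: mult_ac)
  qed
  then show ?thesis
    by (intro bounded_linear.intro bounded_linear_axioms.intro \<open>linear F\<close>) blast
qed

corollary bounded_linear_inv:
  fixes L :: "'a::banach \<Rightarrow> 'b::banach"
  assumes "bounded_linear L" "bij L"
  shows "bounded_linear (inv L)"
proof (rule closed_graph_bounded_linear)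
  interpret bounded_linear L by fact
  have cancel: "inv L (L x) = x" "L (inv L y) = y" for x y
    using \<open>bij L\<close> by (auto simp: bij_is_inj bij_is_surj surj_f_inv_f)
  show "linear (inv L)"
    by (rule linearI) (metis cancel add, metis cancel scaleR)
  fix Y x y
  assume "Y \<longlonglongrightarrow> y" and "(\<lambda>n. inv L (Y n)) \<longlonglongrightarrow> x"
  then have "y = L x"
    using tendsto[of "\<lambda>n. inv L (Y n)" x sequentially] LIMSEQ_unique by (auto simp: cancel)
  then show "inv L y = x"
    by (simp add: cancel)
qed

lemma bounded_linear_id: "bounded_linear id"
  unfolding id_def by (rule bounded_linear_ident)

lemma bij_id_minus_contraction:
  fixes L :: "'a::banach \<Rightarrow> 'a"
  assumes "linear L" and bound: "\<And>x. norm (L x) \<le> c * norm x" and "c < 1"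
  shows "bij (\<lambda>x. x - L x)"
proof -
  interpret linear L by fact
  have "\<exists>!x. y + L x = x" for y
  proof (rule banach_fix_type)
    show "\<forall>x x'. dist (y + L x) (y + L x') \<le> max c 0 * dist x x'"
      using order_trans[OF bound mult_right_mono[OF max.cobounded1]]
      by (simp add: dist_norm flip: diff)
  qed (use \<open>c < 1\<close> in auto)
  then show ?thesis
    unfolding bij_iff by (metis eq_diff_eq)
qed

lemma bij_minus_small_perturbation:
  fixes L :: "'a::banach \<Rightarrow> 'b::banach"
  assumes "bounded_linear L" "bij L"
  obtains \<epsilon> where "\<epsilon> > 0"
    "\<And>E. linear E \<Longrightarrow> (\<And>x. norm (E x) \<le> \<epsilon> * norm x) \<Longrightarrow> bij (\<lambda>x. L x - E x)"
proof -
  interpret inv: bounded_linear "inv L"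
    using assms by (rule bounded_linear_inv)
  obtain K where inv_bound: "K > 0" "\<And>y. norm (inv L y) \<le> norm y * K"
    using inv.pos_bounded by blast
  show thesis
  proof
    show "1 / (2 * K) > 0"
      using inv_bound by simp
    fix E :: "'a \<Rightarrow> 'b"
    assume "linear E" and E_bound: "\<And>x. norm (E x) \<le> 1 / (2 * K) * norm x"
    have "norm (E (inv L y)) \<le> 1 / 2 * norm y" for y
      using order_trans[OF E_bound mult_left_mono[OF inv_bound(2)], of y] inv_bound(1) by simp
    moreover have "linear (\<lambda>y. E (inv L y))"
      using linear_compose[OF inv.linear_axioms \<open>linear E\<close>] by (simp add: o_def)
    ultimately have "bij (\<lambda>y. y - E (inv L y))"
      using bij_id_minus_contraction[of "\<lambda>y. E (inv L y)" "1 / 2"] by simp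
    from bij_comp[OF \<open>bij L\<close> this] show "bij (\<lambda>x. L x - E x)"
      using \<open>bij L\<close> by (simp add: o_def bij_is_inj)
  qed
qed

text \<open>Resolvent identities lead to estimates of this form, in which \<open>N c\<close> bounds the resolvent at \<open>c\<close>.\<close>

lemma tendsto_0_if_resolvent_estimate:
  fixes N \<delta> :: "'a::metric_space \<Rightarrow> real"
  assumes K_nonneg: "K \<ge> 0"
    and estimate: "\<And>c. c \<in> S \<Longrightarrow> 0 \<le> \<delta> c" "\<And>c. c \<in> S \<Longrightarrow> \<delta> c \<le> dist c d * K * N c"
    and triangle: "\<And>c. c \<in> S \<Longrightarrow> 0 \<le> N c" "\<And>c. c \<in> S \<Longrightarrow> N c \<le> N d + \<delta> c"
  shows "(\<delta> \<longlongrightarrow> 0) (at d within S)"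
proof (rule Lim_null_comparison)
  have "norm (\<delta> c) \<le> dist c d * K * (2 * N d)" if near: "c \<in> S" "dist c d < 1 / (2 * (K + 1))" for c
  proof -
    have "dist c d * K \<le> 1 / (2 * (K + 1)) * K"
      using near K_nonneg by (intro mult_right_mono) auto
    also have "\<dots> \<le> 1 / 2"
      using K_nonneg by (simp add: field_simps)
    finally have "dist c d * K * N c \<le> 1 / 2 * N c"
      using triangle(1)[OF near(1)] by (rule mult_right_mono)
    then have "N c \<le> 2 * N d"
      using estimate(2) triangle(2) near(1) by fastforce
    then show ?thesis
      using estimate[OF near(1)] K_nonneg mult_left_mono[of "N c" "2 * N d" "dist c d * K"] by simp
  qed
  then show "\<forall>\<^sub>F c in at d within S. norm (\<delta> c) \<le> dist c d * K * (2 * N d)"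
    unfolding eventually_at using K_nonneg by (intro exI[of _ "1 / (2 * (K + 1))"]) simp
  have "((\<lambda>c. dist c d * K * (2 * N d)) \<longlongrightarrow> dist d d * K * (2 * N d)) (at d within S)"
    by (intro tendsto_intros)
  then show "((\<lambda>c. dist c d * K * (2 * N d)) \<longlongrightarrow> 0) (at d within S)"
    by simp
qed

section \<open>Maximal ideals and the Gelfand--Mazur theorem\<close>

lemma module_times: "module ((*) :: 'a::comm_ring_1 \<Rightarrow> 'a \<Rightarrow> 'a)"
  by unfold_locales (simp_all add: algebra_simps)

lemma is_ideal_iff_subspace: "is_ideal I \<longleftrightarrow> module.subspace (*) I"
  by (auto simp: is_ideal_def module.subspace_def[OF module_times])

lemma one_notin_maximal_ideal:
  assumes "maximal_ideal M"
  shows "1 \<notin> M"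
proof
  assume "1 \<in> M"
  then have "y \<in> M" for y
    using assms unfolding maximal_ideal_def is_ideal_def by (metis mult.right_neutral)
  then show False
    using assms by (auto simp: maximal_ideal_def)
qed

lemma invertible_mod_maximal_ideal:
  fixes x :: "'a::comm_ring_1"
  assumes "maximal_ideal M" "x \<notin> M"
  shows "\<exists>y. x * y - 1 \<in> M"
proof -
  interpret module "(*) :: 'a \<Rightarrow> 'a \<Rightarrow> 'a"
    by (rule module_times)
  have M_subspace: "subspace M"
    using assms(1) by (simp add: maximal_ideal_def is_ideal_iff_subspace)
  have "is_ideal (span (insert x M))" "M \<subseteq> span (insert x M)" "x \<in> span (insert x M)"
    using span_superset[of "insert x M"] by (auto simp: is_ideal_iff_subspace)
  then have "span (insert x M) = UNIV"
    using assms by (auto simp: maximal_ideal_def)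
  then have "1 \<in> span (insert x M)"
    by simp
  then obtain k where "1 - k * x \<in> M"
    using M_subspace unfolding span_insert span_eq_iff[THEN iffD2, OF M_subspace] by blast
  then show ?thesis
    using subspace_neg[OF M_subspace, of "1 - k * x"] by (metis minus_diff_eq mult.commute)
qed

lemma sum_power_roots_unity:
  assumes "i < n"
  shows "(\<Sum>\<zeta> | \<zeta> ^ n = (1::complex). \<zeta> ^ i) = (if i = 0 then of_nat n else 0)"
proof (cases "i = 0")
  case True
  then show ?thesis
    using card_roots_unity_eq[of n] assms by simp
next
  case False
  let ?R = "\<lambda>n. {\<zeta>::complex. \<zeta> ^ n = 1}"
  have "card (?R i) < card (?R n)"
    using card_roots_unity_eq[of i] card_roots_unity_eq[of n] False assms by simp
  then have "\<not> ?R n \<subseteq> ?R i"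
    using finite_roots_unity[of i] False card_mono[of "?R i" "?R n"] by fastforce
  then obtain \<omega> :: complex where \<omega>: "\<omega> ^ n = 1" "\<omega> ^ i \<noteq> 1"
    by blast
  then have "\<omega> \<noteq> 0"
    using assms by (auto simp: power_0_left split: if_splits)
  have "(\<Sum>\<zeta>\<in>?R n. \<zeta> ^ i) = (\<Sum>\<zeta>\<in>?R n. (\<omega> * \<zeta>) ^ i)"
    by (rule sum.reindex_bij_witness[of _ "\<lambda>\<zeta>. \<omega> * \<zeta>" "\<lambda>\<zeta>. \<zeta> / \<omega>"])
      (use \<omega> \<open>\<omega> \<noteq> 0\<close> in \<open>auto simp: power_mult_distrib power_divide\<close>)
  also have "\<dots> = \<omega> ^ i * (\<Sum>\<zeta>\<in>?R n. \<zeta> ^ i)"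
    by (simp add: power_mult_distrib sum_distrib_left)
  finally show ?thesis
    using \<omega> False by simp
qed

lemma continuous_vanishing_at_infinity_attains_max:
  fixes N :: "'a::{real_normed_vector,heine_borel} \<Rightarrow> real"
  assumes "continuous_on UNIV N" and vanish: "(N \<longlongrightarrow> 0) at_infinity" and "N a > 0"
  obtains c where "\<And>d. N d \<le> N c"
proof -
  obtain b where small_outside: "\<And>d. b \<le> norm d \<Longrightarrow> N d < N a"
    using order_tendstoD(2)[OF vanish \<open>N a > 0\<close>] by (auto simp: eventually_at_infinity)
  define B where "B = cball (0::'a) (max b (norm a))"
  have "a \<in> B"
    by (simp add: B_def)
  moreover have "continuous_on B N"
    using assms(1) continuous_on_subset by blast
  moreover have "compact B"
    by (simp add: B_def)
  ultimately obtain c where max_on_B: "\<And>d. d \<in> B \<Longrightarrow> N d \<le> N c"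
    using continuous_attains_sup[of B N] by blast
  have "N d \<le> N c" for d
  proof (cases "d \<in> B")
    case False
    then have "N d < N a"
      by (intro small_outside) (simp add: B_def)
    then show ?thesis
      using max_on_B[OF \<open>a \<in> B\<close>] by simp
  qed (rule max_on_B)
  then show ?thesis
    using that by blast
qed

lemma filterlim_arithmetic_progression_at_infinity:
  fixes c s :: "'a::real_normed_field"
  assumes "s \<noteq> 0"
  shows "filterlim (\<lambda>k. c + of_nat k * s) at_infinity sequentially"
proof (intro tendsto_add_filterlim_at_infinity[OF tendsto_const] filterlim_norm_at_top_imp_at_infinity)
  show "LIM k sequentially. norm (of_nat k * s) :> at_top"
    unfolding norm_mult norm_of_nat using assms
    by (intro filterlim_at_top_mult_tendsto_pos[OF tendsto_const] filterlim_real_sequentially) simp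
qed

locale complex_banach_algebra =
  fixes j :: "'a::{real_normed_algebra_1,comm_ring_1,banach}"
  assumes complex_structure: "complex_structure j"
begin

definition emb :: "complex \<Rightarrow> 'a" where
  "emb c = of_real (Re c) + of_real (Im c) * j"

lemma cscale_eq: "cscale j c x = emb c * x"
  by (simp add: cscale_def emb_def)

lemma emb_of_real: "emb (of_real r) = of_real r"
  by (simp add: emb_def)

lemma emb_0 [simp]: "emb 0 = 0"
  and emb_1 [simp]: "emb 1 = 1"
  and emb_of_nat [simp]: "emb (of_nat n) = of_nat n"
  using emb_of_real[of 0] emb_of_real[of 1] emb_of_real[of "of_nat n"] by simp_all

lemma emb_add: "emb (c + d) = emb c + emb d"
  and emb_minus: "emb (- c) = - emb c"
  and emb_diff: "emb (c - d) = emb c - emb d"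
  by (simp_all add: emb_def algebra_simps)

lemma emb_mult: "emb (c * d) = emb c * emb d"
proof -
  have j_square: "j * j = - 1"
    using complex_structure by (simp add: complex_structure_def)
  have j_j_mult: "j * (j * x) = - x" for x
    by (simp add: j_square flip: mult.assoc)
  show ?thesis
    by (simp add: emb_def algebra_simps j_square j_j_mult)
qed

lemma emb_power: "emb (c ^ n) = emb c ^ n"
  by (induction n) (auto simp: emb_mult)

lemma emb_sum: "emb (sum f A) = (\<Sum>a\<in>A. emb (f a))"
  by (induction A rule: infinite_finite_induct) (auto simp: emb_add)

lemma norm_emb_mult: "norm (emb c * x) = cmod c * norm x"
  using complex_structure by (simp add: complex_structure_def cscale_eq)

lemma norm_emb: "norm (emb c) = cmod c"
  using norm_emb_mult[of c 1] by simp

lemma emb_mult_inverse_cancel: "c \<noteq> 0 \<Longrightarrow> emb c * (emb (inverse c) * x) = x"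
  by (simp flip: emb_mult mult.assoc)

lemma one_minus_invertible:
  fixes y :: 'a
  assumes "norm y < 1"
  shows "\<exists>z. (1 - y) * z = 1"
proof -
  have "bij (\<lambda>x. x - y * x)"
    using assms by (intro bij_id_minus_contraction[where c = "norm y"])
      (auto intro: linearI simp: algebra_simps norm_mult_ineq)
  then obtain z where "z - y * z = 1"
    using bij_is_surj surjD[of "\<lambda>x. x - y * x" 1] by metis
  then show ?thesis
    by (intro exI[of _ z]) (simp add: algebra_simps)
qed

end

locale proper_ideal = complex_banach_algebra +
  fixes I :: "'a set"
  assumes ideal: "is_ideal I" and one_notin_ideal: "1 \<notin> I"
begin

lemmas ideal_subspace = ideal[unfolded is_ideal_iff_subspace]

lemmas ideal_zero = module.subspace_0[OF module_times ideal_subspace]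
  and ideal_add = module.subspace_add[OF module_times ideal_subspace]
  and ideal_minus = module.subspace_neg[OF module_times ideal_subspace]
  and ideal_diff = module.subspace_diff[OF module_times ideal_subspace]
  and ideal_mult = module.subspace_scale[OF module_times ideal_subspace]
  and ideal_sum = module.subspace_sum[OF module_times ideal_subspace]

definition quot_norm :: "'a \<Rightarrow> real" where
  "quot_norm x = infdist x I"

lemma quot_norm_nonneg: "0 \<le> quot_norm x"
  by (simp add: quot_norm_def infdist_nonneg)

lemma quot_norm_le: "u \<in> I \<Longrightarrow> quot_norm x \<le> norm (x - u)"
  by (metis quot_norm_def infdist_le dist_norm)

lemma quot_norm_geI: "(\<And>u. u \<in> I \<Longrightarrow> b \<le> norm (x - u)) \<Longrightarrow> b \<le> quot_norm x"
  unfolding quot_norm_def infdist_def using ideal_zero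
  by (auto simp: dist_norm intro!: cINF_greatest)

lemma quot_norm_le_norm: "quot_norm x \<le> norm x"
  using quot_norm_le[OF ideal_zero, of x] by simp

lemma quot_norm_0 [simp]: "quot_norm 0 = 0"
  using quot_norm_le_norm[of 0] quot_norm_nonneg[of 0] by simp

lemma quot_norm_cong:
  assumes "x - y \<in> I"
  shows "quot_norm x = quot_norm y"
proof -
  have "quot_norm x \<le> quot_norm y" if "x - y \<in> I" for x y
  proof (rule quot_norm_geI)
    fix u assume "u \<in> I"
    then show "quot_norm x \<le> norm (y - u)"
      using quot_norm_le[OF ideal_add[OF that], of u x] by simp
  qed
  moreover have "y - x \<in> I"
    using ideal_minus[OF assms] by simp
  ultimately show ?thesis
    using assms by (intro antisym) auto
qed

lemma quot_norm_add: "quot_norm (x + y) \<le> quot_norm x + quot_norm y"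
proof -
  have "quot_norm (x + y) - norm (x - u) \<le> norm (y - v)" if "u \<in> I" "v \<in> I" for u v
    using quot_norm_le[OF ideal_add[OF that], of "x + y"] norm_triangle_ineq[of "x - u" "y - v"]
    by (simp add: algebra_simps)
  then have "quot_norm (x + y) - norm (x - u) \<le> quot_norm y" if "u \<in> I" for u
    using that by (intro quot_norm_geI) auto
  then have "quot_norm (x + y) - quot_norm y \<le> quot_norm x"
    by (intro quot_norm_geI) (auto simp: algebra_simps)
  then show ?thesis
    by simp
qed

lemma quot_norm_mult_le_norm: "quot_norm (x * y) \<le> norm x * quot_norm y"
proof (cases "x = 0")
  case False
  have "quot_norm (x * y) / norm x \<le> norm (y - u)" if "u \<in> I" for u
    using quot_norm_le[OF ideal_mult[OF that], of "x * y" x] norm_mult_ineq[of x "y - u"] False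
    by (simp add: algebra_simps divide_le_eq)
  then have "quot_norm (x * y) / norm x \<le> quot_norm y"
    by (rule quot_norm_geI)
  then show ?thesis
    using False by (simp add: divide_le_eq mult.commute)
qed simp

lemma quot_norm_mult: "quot_norm (x * y) \<le> quot_norm x * quot_norm y"
proof -
  have bound: "quot_norm (x * y) \<le> norm (x - u) * quot_norm y" if "u \<in> I" for u
  proof -
    have "quot_norm (x * y) = quot_norm ((x - u) * y)"
      using ideal_mult[OF that, of y] by (intro quot_norm_cong) (simp add: algebra_simps)
    then show ?thesis
      using quot_norm_mult_le_norm[of "x - u" y] by simp
  qed
  show ?thesis
  proof (cases "quot_norm y = 0")
    case True
    then show ?thesis
      using bound[OF ideal_zero] by simp
  next
    case False
    then have y_pos: "quot_norm y > 0"
      using quot_norm_nonneg[of y] by simp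
    then have "quot_norm (x * y) / quot_norm y \<le> quot_norm x"
      using bound by (intro quot_norm_geI) (simp add: divide_le_eq)
    then show ?thesis
      using y_pos by (simp add: divide_le_eq)
  qed
qed

lemma quot_norm_1: "quot_norm 1 = 1"
proof (rule antisym)
  show "quot_norm 1 \<le> 1"
    using quot_norm_le_norm[of 1] by simp
  show "1 \<le> quot_norm 1"
  proof (rule quot_norm_geI, rule ccontr)
    fix u assume u_near_1: "u \<in> I" "\<not> 1 \<le> norm (1 - u)"
    then obtain z where "u * z = 1"
      using one_minus_invertible[of "1 - u"] by auto
    then show False
      using ideal_mult[OF u_near_1(1), of z] one_notin_ideal by (simp add: mult.commute)
  qed
qed

lemma quot_norm_power: "quot_norm (x ^ n) \<le> quot_norm x ^ n"
proof (induction n)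
  case (Suc n)
  then show ?case
    using order_trans[OF quot_norm_mult mult_left_mono[OF Suc quot_norm_nonneg]] by simp
qed (simp add: quot_norm_1)

lemma quot_norm_emb_mult: "quot_norm (emb c * x) = cmod c * quot_norm x"
proof (cases "c = 0")
  case False
  have emb_mult_le: "quot_norm (emb c * x) \<le> cmod c * quot_norm x" for c x
    using quot_norm_mult_le_norm[of "emb c" x] by (simp add: norm_emb)
  have "quot_norm x \<le> inverse (cmod c) * quot_norm (emb c * x)"
    using emb_mult_le[of "inverse c" "emb c * x"] emb_mult_inverse_cancel[OF False, of x]
    by (simp only: norm_inverse mult.left_commute)
  then have "cmod c * quot_norm x \<le> quot_norm (emb c * x)"
    using False by (simp add: field_simps)
  then show ?thesis
    using emb_mult_le[of c x] by simp
qed simp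

lemma quot_norm_minus: "quot_norm (- x) = quot_norm x"
  using quot_norm_emb_mult[of "- 1" x] by (simp add: emb_minus)

lemma quot_norm_diff: "quot_norm (x - y) \<le> quot_norm x + quot_norm y"
  using quot_norm_add[of x "- y"] by (simp add: quot_norm_minus)

lemma quot_norm_sum: "quot_norm (sum f A) \<le> (\<Sum>a\<in>A. quot_norm (f a))"
proof (induction A rule: infinite_finite_induct)
  case (insert a A)
  then show ?case
    using quot_norm_add[of "f a" "sum f A"] by simp
qed simp_all

lemma abs_quot_norm_diff_le: "\<bar>quot_norm x - quot_norm y\<bar> \<le> quot_norm (x - y)"
  using quot_norm_add[of "x - y" y] quot_norm_diff[of x "x - y"] by simp

definition inverse_mod :: "'a \<Rightarrow> 'a \<Rightarrow> bool" where
  "inverse_mod x y \<longleftrightarrow> x * y - 1 \<in> I"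

lemma quot_norm_resolvent_diff:
  assumes "inverse_mod (x - emb c) a" "inverse_mod (x - emb d) b"
  shows "quot_norm (a - b) \<le> cmod (c - d) * quot_norm b * quot_norm a"
proof -
  have "(a - b) - emb (c - d) * (b * a) = b * ((x - emb c) * a - 1) - a * ((x - emb d) * b - 1)"
    by (simp add: algebra_simps emb_diff)
  then have "quot_norm (a - b) = quot_norm (emb (c - d) * (b * a))"
    using assms by (intro quot_norm_cong) (auto simp: inverse_mod_def intro: ideal_diff ideal_mult)
  then show ?thesis
    using mult_left_mono[OF quot_norm_mult[of b a], of "cmod (c - d)"]
    by (simp add: quot_norm_emb_mult mult.assoc)
qed

lemma continuous_on_quot_norm_resolvent:
  assumes "\<And>c. c \<in> D \<Longrightarrow> inverse_mod (x - emb c) (r c)"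
  shows "continuous_on D (\<lambda>c. quot_norm (r c))"
  unfolding continuous_on
proof
  fix d assume d_in_D: "d \<in> D"
  have "((\<lambda>c. \<bar>quot_norm (r c) - quot_norm (r d)\<bar>) \<longlongrightarrow> 0) (at d within D)"
  proof (rule tendsto_0_if_resolvent_estimate[OF quot_norm_nonneg])
    show "\<bar>quot_norm (r c) - quot_norm (r d)\<bar> \<le> dist c d * quot_norm (r d) * quot_norm (r c)"
      if "c \<in> D" for c
      unfolding dist_norm using assms d_in_D that
      by (intro order_trans[OF abs_quot_norm_diff_le quot_norm_resolvent_diff])
  qed (auto simp: quot_norm_nonneg)
  then show "((\<lambda>c. quot_norm (r c)) \<longlongrightarrow> quot_norm (r d)) (at d within D)"
    by (rule LIM_zero_cancel[OF tendsto_rabs_zero_cancel])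
qed

lemma quot_norm_resolvent_decay:
  assumes "inverse_mod (x - emb c) a"
  shows "(cmod c - quot_norm x) * quot_norm a \<le> 1"
proof -
  have "emb c * a - (x * a - 1) = 0 - ((x - emb c) * a - 1)"
    by (simp add: algebra_simps)
  then have "quot_norm (emb c * a) = quot_norm (x * a - 1)"
    using assms ideal_diff[OF ideal_zero] unfolding inverse_mod_def by (metis quot_norm_cong)
  then have "cmod c * quot_norm a \<le> quot_norm (x * a) + 1"
    using quot_norm_diff[of "x * a" 1] by (simp add: quot_norm_emb_mult quot_norm_1)
  then show ?thesis
    using quot_norm_mult[of x a] by (simp add: algebra_simps)
qed

lemma quot_norm_inverse_mod_pos:
  assumes "inverse_mod x a"
  shows "quot_norm a > 0"
proof -
  have "1 = quot_norm (x * a)"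
    using assms quot_norm_cong[of "x * a" 1] by (simp add: inverse_mod_def quot_norm_1)
  then have "quot_norm a \<noteq> 0"
    using quot_norm_mult[of x a] by auto
  then show ?thesis
    using quot_norm_nonneg[of a] by simp
qed

lemma sum_resolvent_roots_unity:
  assumes inverse_at_center: "inverse_mod (x - emb c) a" and "n > 0"
    and inverse_on_circle: "\<And>\<zeta>. \<zeta> ^ n = 1 \<Longrightarrow> inverse_mod (x - emb (c + \<mu> * \<zeta>)) (b \<zeta>)"
  shows "(\<Sum>\<zeta> | \<zeta> ^ n = 1. b \<zeta>) * (1 - (emb \<mu> * a) ^ n) - of_nat n * a \<in> I"
proof -
  define z where "z = emb \<mu> * a"
  define g where "g \<zeta> = (\<Sum>i<n. (emb \<zeta> * z) ^ i)" for \<zeta>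
  have "b \<zeta> * (1 - z ^ n) - a * g \<zeta> \<in> I" if "\<zeta> ^ n = 1" for \<zeta>
  proof -
    have "(1 - emb \<zeta> * z) * b \<zeta> - a
        = a * ((x - emb (c + \<mu> * \<zeta>)) * b \<zeta> - 1) - b \<zeta> * ((x - emb c) * a - 1)"
      by (simp add: z_def emb_add emb_mult algebra_simps)
    then have "(1 - emb \<zeta> * z) * b \<zeta> - a \<in> I"
      using inverse_at_center inverse_on_circle[OF that]
      by (auto simp: inverse_mod_def intro: ideal_diff ideal_mult)
    then have "g \<zeta> * ((1 - emb \<zeta> * z) * b \<zeta> - a) \<in> I"
      by (rule ideal_mult)
    moreover have "1 - z ^ n = (1 - emb \<zeta> * z) * g \<zeta>"
      using one_diff_power_eq[of "emb \<zeta> * z" n] that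
      by (simp add: g_def power_mult_distrib flip: emb_power)
    ultimately show ?thesis
      by (simp add: right_diff_distrib mult_ac)
  qed
  then have "(\<Sum>\<zeta> | \<zeta> ^ n = 1. b \<zeta> * (1 - z ^ n) - a * g \<zeta>) \<in> I"
    by (intro ideal_sum) simp
  moreover have "(\<Sum>\<zeta> | \<zeta> ^ n = 1. g \<zeta>) = of_nat n"
  proof -
    have "(\<Sum>\<zeta> | \<zeta> ^ n = 1. g \<zeta>) = (\<Sum>i<n. \<Sum>\<zeta> | \<zeta> ^ n = 1. emb (\<zeta> ^ i) * z ^ i)"
      unfolding g_def by (subst sum.swap) (simp add: power_mult_distrib emb_power)
    also have "\<dots> = (\<Sum>i<n. if i = 0 then of_nat n else 0)"
      by (rule sum.cong) (auto simp: sum_power_roots_unity simp flip: emb_sum sum_distrib_right)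
    also have "\<dots> = of_nat n"
      using \<open>n > 0\<close> by simp
    finally show ?thesis .
  qed
  ultimately show ?thesis
    by (simp add: z_def sum_subtractf mult.commute flip: sum_distrib_right sum_distrib_left)
qed

text \<open>Up to an error of order \<open>\<theta> ^ n\<close>, where \<open>\<theta> = cmod \<mu> * quot_norm (r c)\<close>, the resolvent at \<open>c\<close> is the
  mean of \<open>n\<close> values on the circle, one of them at \<open>c + \<mu>\<close>. Hence its norm at \<open>c + \<mu>\<close> falls short of
  the maximum by at most \<open>n\<close> times the error.\<close>

lemma quot_norm_resolvent_circle_estimate:
  assumes resolvent: "\<And>d. d \<in> insert c (sphere c (cmod \<mu>)) \<Longrightarrow> inverse_mod (x - emb d) (r d)"
    and max: "\<And>d. d \<in> sphere c (cmod \<mu>) \<Longrightarrow> quot_norm (r d) \<le> quot_norm (r c)"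
    and "n > 0"
  shows "quot_norm (r c) - quot_norm (r (c + \<mu>)) \<le> n * quot_norm (r c) * (cmod \<mu> * quot_norm (r c)) ^ n"
proof -
  let ?R = "{\<zeta>::complex. \<zeta> ^ n = 1}"
  define m where "m = quot_norm (r c)"
  define \<delta> where "\<delta> = m - quot_norm (r (c + \<mu>))"
  define A where "A = (\<Sum>\<zeta>\<in>?R. r (c + \<mu> * \<zeta>))"
  define z where "z = emb \<mu> * r c"
  have roots: "finite ?R" "card ?R = n" "1 \<in> ?R"
    using \<open>n > 0\<close> finite_roots_unity[of n] card_roots_unity_eq[of n] by auto
  have circle: "c + \<mu> * \<zeta> \<in> sphere c (cmod \<mu>)" if "\<zeta> \<in> ?R" for \<zeta>
    using that \<open>n > 0\<close> power_eq_1_iff[of \<zeta> n] by (simp add: dist_norm norm_mult)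
  have "0 \<le> \<delta>"
    using max[OF circle[OF roots(3)]] by (simp add: \<delta>_def m_def)
  have "quot_norm A \<le> (\<Sum>\<zeta>\<in>?R. quot_norm (r (c + \<mu> * \<zeta>)))"
    unfolding A_def by (rule quot_norm_sum)
  also have "\<dots> \<le> quot_norm (r (c + \<mu> * 1)) + (\<Sum>\<zeta>\<in>?R - {1}. m)"
    unfolding sum.remove[OF roots(1,3)] m_def by (intro add_left_mono sum_mono max circle) simp
  also have "\<dots> = n * m - \<delta>"
    using roots \<open>n > 0\<close> by (simp add: \<delta>_def algebra_simps)
  finally have sum_bound: "quot_norm A \<le> n * m - \<delta>" .
  have "quot_norm (z ^ n) \<le> (cmod \<mu> * m) ^ n"
    using quot_norm_power[of z n] by (simp add: z_def m_def quot_norm_emb_mult)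
  then have product_bound: "quot_norm (A * z ^ n) \<le> (n * m - \<delta>) * (cmod \<mu> * m) ^ n"
    using sum_bound order_trans[OF quot_norm_nonneg sum_bound]
    by (intro order_trans[OF quot_norm_mult] mult_mono) (auto simp: quot_norm_nonneg)
  have "n * m = quot_norm (emb (of_nat n) * r c)"
    unfolding quot_norm_emb_mult by (simp add: m_def)
  also have "\<dots> = quot_norm (A - A * z ^ n)"
    using sum_resolvent_roots_unity[of x c "r c" n \<mu> "\<lambda>\<zeta>. r (c + \<mu> * \<zeta>)"] \<open>n > 0\<close> resolvent circle
    by (intro quot_norm_cong[symmetric]) (simp add: A_def z_def algebra_simps)
  also have "\<dots> \<le> (n * m - \<delta>) + (n * m - \<delta>) * (cmod \<mu> * m) ^ n"
    using sum_bound product_bound by (intro order_trans[OF quot_norm_diff]) simp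
  finally have "\<delta> \<le> (n * m - \<delta>) * (cmod \<mu> * m) ^ n"
    by simp
  also have "\<dots> \<le> n * m * (cmod \<mu> * m) ^ n"
    using \<open>0 \<le> \<delta>\<close> by (intro mult_right_mono) (auto simp: m_def quot_norm_nonneg)
  finally show ?thesis
    by (simp add: \<delta>_def m_def)
qed

lemma quot_norm_resolvent_maximum_principle:
  assumes resolvent: "\<And>d. d \<in> insert c (sphere c (cmod \<mu>)) \<Longrightarrow> inverse_mod (x - emb d) (r d)"
    and max: "\<And>d. d \<in> sphere c (cmod \<mu>) \<Longrightarrow> quot_norm (r d) \<le> quot_norm (r c)"
    and small: "cmod \<mu> * quot_norm (r c) < 1"
  shows "quot_norm (r (c + \<mu>)) = quot_norm (r c)"
proof (rule antisym)
  let ?m = "quot_norm (r c)"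
  show "quot_norm (r (c + \<mu>)) \<le> ?m"
    by (rule max) (simp add: dist_norm)
  have "(\<lambda>n. ?m * (of_nat n * (cmod \<mu> * ?m) ^ n)) \<longlonglongrightarrow> ?m * 0"
    using small by (intro tendsto_intros powser_times_n_limit_0) (simp add: quot_norm_nonneg)
  moreover have "?m - quot_norm (r (c + \<mu>)) \<le> ?m * (of_nat n * (cmod \<mu> * ?m) ^ n)" if "n \<ge> 1" for n
    using quot_norm_resolvent_circle_estimate[OF resolvent max, where n = n] that by (simp add: mult_ac)
  ultimately have "?m - quot_norm (r (c + \<mu>)) \<le> 0"
    by (intro LIMSEQ_le_const) auto
  then show "?m \<le> quot_norm (r (c + \<mu>))"
    by simp
qed

theorem spectrum_mod_ideal_nonempty: "\<exists>c. \<forall>y. \<not> inverse_mod (x - emb c) y"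
proof (rule ccontr)
  assume "\<not> ?thesis"
  then obtain r where resolvent: "\<And>c. inverse_mod (x - emb c) (r c)"
    by metis
  define N where "N c = quot_norm (r c)" for c
  have N_pos: "N c > 0" for c
    unfolding N_def using resolvent by (rule quot_norm_inverse_mod_pos)
  have vanish: "(N \<longlongrightarrow> 0) at_infinity"
  proof (rule Lim_null_comparison)
    show "\<forall>\<^sub>F c in at_infinity. norm (N c) \<le> inverse (cmod c - quot_norm x)"
      unfolding eventually_at_infinity
    proof (intro exI allI impI)
      fix c assume "quot_norm x + 1 \<le> cmod c"
      then show "norm (N c) \<le> inverse (cmod c - quot_norm x)"
        using quot_norm_resolvent_decay[OF resolvent[of c]] N_pos[of c] by (simp add: N_def field_simps)
    qed
    show "((\<lambda>c. inverse (cmod c - quot_norm x)) \<longlongrightarrow> 0) at_infinity"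
      using filterlim_tendsto_add_at_top[OF tendsto_const[of "- quot_norm x"] filterlim_norm_at_top]
      by (intro tendsto_inverse_0_at_top) simp
  qed
  have "continuous_on UNIV N"
    unfolding N_def using resolvent by (intro continuous_on_quot_norm_resolvent)
  then obtain c where maximal: "\<And>d. N d \<le> N c"
    using continuous_vanishing_at_infinity_attains_max[OF _ vanish N_pos[of 0]] by blast
  define s :: complex where "s = of_real (1 / (2 * N c))"
  have step: "s \<noteq> 0" "cmod s * N c < 1"
    using N_pos[of c] by (auto simp: s_def norm_divide)
  have "N (c + of_nat k * s) = N c" for k
  proof (induction k)
    case (Suc k)
    then have "N (c + of_nat k * s + s) = N c"
      using quot_norm_resolvent_maximum_principle[of "c + of_nat k * s" s x r]
        resolvent maximal step by (simp add: N_def)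
    then show ?case
      by (simp add: algebra_simps)
  qed simp
  then have "(\<lambda>k::nat. N c) \<longlonglongrightarrow> 0"
    using filterlim_compose[OF vanish filterlim_arithmetic_progression_at_infinity[OF step(1), of c]]
    by simp
  then show False
    using N_pos[of c] by (simp add: LIMSEQ_const_iff)
qed

end

corollary (in complex_banach_algebra) Gelfand_Mazur:
  assumes "maximal_ideal M"
  shows "\<exists>c. x - emb c \<in> M"
proof -
  interpret proper_ideal j M
    using assms by unfold_locales (auto simp: maximal_ideal_def one_notin_maximal_ideal)
  show ?thesis
    using spectrum_mod_ideal_nonempty[of x] invertible_mod_maximal_ideal[OF assms]
    unfolding inverse_mod_def by blast
qed

section \<open>The maximal ideal space and the Shilov boundary\<close>

context complex_banach_algebra
begin

abbreviation chars :: "('a \<Rightarrow> complex) set" where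
  "chars \<equiv> max_ideal_space j"

abbreviation shilov :: "('a \<Rightarrow> complex) set" where
  "shilov \<equiv> shilov_boundary j"

lemma
  assumes "m \<in> chars"
  shows char_add: "m (x + y) = m x + m y"
    and char_mult: "m (x * y) = m x * m y"
    and char_emb_mult: "m (emb c * x) = c * m x"
    and char_1: "m 1 = 1"
    and char_diff: "m (x - y) = m x - m y"
    and char_power: "m (x ^ n) = m x ^ n"
    and char_emb: "m (emb c) = c"
proof -
  show add: "m (x + y) = m x + m y" and mult: "m (x * y) = m x * m y"
    and emb: "m (emb c * x) = c * m x" and one: "m 1 = 1" for x y c
    using assms unfolding max_ideal_space_def cscale_eq by blast+
  show "m (x - y) = m x - m y"
    using add[of x "- y"] emb[of "- 1" y] by (simp add: emb_minus)
  show "m (x ^ n) = m x ^ n"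
    by (induction n) (auto simp: one mult)
  show "m (emb c) = c"
    using emb[of c 1] one by simp
qed

lemma char_le_norm:
  assumes m_char: "m \<in> chars"
  shows "cmod (m x) \<le> norm x"
proof (rule ccontr)
  assume less: "\<not> ?thesis"
  then have "m x \<noteq> 0"
    by auto
  define y where "y = emb (inverse (m x)) * x"
  have "norm y = norm x / cmod (m x)"
    unfolding y_def norm_emb_mult by (simp add: norm_inverse divide_inverse mult.commute)
  then have "norm y < 1"
    using less \<open>m x \<noteq> 0\<close> by (simp add: divide_less_eq)
  then obtain z where "(1 - y) * z = 1"
    using one_minus_invertible by blast
  moreover have "m (1 - y) = 0"
    using \<open>m x \<noteq> 0\<close> by (simp add: y_def char_diff[OF m_char] char_1[OF m_char] char_emb_mult[OF m_char])
  ultimately show False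
    using char_mult[OF m_char, of "1 - y" z] char_1[OF m_char] by simp
qed

lemma bounded_linear_char:
  assumes m_char: "m \<in> chars"
  shows "bounded_linear m"
proof (rule bounded_linear_intro[where K = 1])
  show "m (r *\<^sub>R x) = r *\<^sub>R m x" for r x
    using char_emb_mult[OF m_char, of "of_real r" x] by (simp add: emb_of_real scaleR_conv_of_real)
qed (use char_le_norm[OF m_char] in \<open>auto simp: char_add[OF m_char]\<close>)

lemma char_of_maximal_ideal:
  assumes "maximal_ideal M"
  obtains m where "m \<in> chars" "\<And>x. m x = 0 \<longleftrightarrow> x \<in> M"
proof -
  interpret proper_ideal j M
    using assms by unfold_locales (auto simp: maximal_ideal_def one_notin_maximal_ideal)
  obtain m where m_mod: "\<And>x. x - emb (m x) \<in> M"
    using Gelfand_Mazur[OF assms] by metis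
  have m_eq: "m x = c" if "x - emb c \<in> M" for x c
  proof (rule ccontr)
    assume "m x \<noteq> c"
    have "emb (inverse (m x - c)) * ((x - emb c) - (x - emb (m x))) \<in> M"
      by (rule ideal_mult[OF ideal_diff[OF that m_mod]])
    then show False
      using one_notin_ideal \<open>m x \<noteq> c\<close> by (simp flip: emb_mult emb_diff)
  qed
  have "m \<in> chars"
    unfolding max_ideal_space_def
  proof (intro CollectI conjI allI)
    show "m (x + y) = m x + m y" for x y
      using ideal_add[OF m_mod[of x] m_mod[of y]] by (intro m_eq) (simp add: emb_add algebra_simps)
    show "m (x * y) = m x * m y" for x y
    proof (rule m_eq)
      have "x * y - emb (m x * m y) = x * (y - emb (m y)) + emb (m y) * (x - emb (m x))"
        by (simp add: emb_mult algebra_simps)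
      then show "x * y - emb (m x * m y) \<in> M"
        using m_mod by (auto intro: ideal_add ideal_mult)
    qed
    show "m (cscale j c x) = c * m x" for c x
      using ideal_mult[OF m_mod, of "emb c" x]
      by (intro m_eq) (simp add: cscale_eq emb_mult algebra_simps)
    show "m 1 = 1"
      by (rule m_eq) (simp add: ideal_zero)
  qed
  moreover have "m x = 0 \<longleftrightarrow> x \<in> M" for x
    using m_mod[of x] m_eq[of x 0] by auto
  ultimately show thesis
    by (rule that)
qed

lemma chars_separate:
  assumes "semisimple TYPE('a)" "\<And>m. m \<in> chars \<Longrightarrow> m x = 0"
  shows "x = 0"
proof (rule ccontr)
  assume "x \<noteq> 0"
  then obtain M where "maximal_ideal M" "x \<notin> M"
    using assms(1) unfolding semisimple_def by blast
  then show False
    using char_of_maximal_ideal assms(2) by metis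
qed

lemma continuous_on_eval: "continuous_on K (\<lambda>m::'a \<Rightarrow> complex. m x)"
  by (rule continuous_on_subset[OF continuous_on_product_coordinates]) simp

lemma closed_chars: "closed chars"
  unfolding max_ideal_space_def
  by (intro closed_Collect_conj closed_Collect_all closed_Collect_eq continuous_intros
      continuous_on_eval)

lemma compact_if_closed_subset_chars:
  assumes "closed K" "K \<subseteq> chars"
  shows "compact K"
proof -
  have "compactin (product_topology (\<lambda>x. euclidean) UNIV)
      (PiE UNIV (\<lambda>x::'a. cball (0::complex) (norm x)))"
    unfolding compactin_PiE by simp
  then have "compact (PiE UNIV (\<lambda>x::'a. cball (0::complex) (norm x)))"
    by (simp add: euclidean_product_topology)
  moreover have "K \<subseteq> PiE UNIV (\<lambda>x::'a. cball 0 (norm x))"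
    using char_le_norm assms(2) by (auto simp: PiE_iff)
  ultimately show ?thesis
    using assms(1) compact_Int_closed[of _ K] by (metis inf.absorb2)
qed

lemma char_attains_max:
  assumes "closed K" "K \<subseteq> chars" "K \<noteq> {}"
  obtains e where "e \<in> K" "\<And>m. m \<in> K \<Longrightarrow> cmod (m f) \<le> cmod (e f)"
  using continuous_attains_sup[OF compact_if_closed_subset_chars[OF assms(1,2)] assms(3)
      continuous_on_norm[OF continuous_on_eval[of K f]]] by blast

lemma closedin_chars_iff: "closedin (top_of_set chars) B \<longleftrightarrow> closed B \<and> B \<subseteq> chars"
  using closed_chars by (rule closedin_closed_eq)

lemma boundary_max:
  assumes "is_boundary j B"
  obtains b where "b \<in> B" "\<And>m. m \<in> chars \<Longrightarrow> cmod (m f) \<le> cmod (b f)"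
  using assms unfolding is_boundary_def by blast

lemma boundary_subset: "is_boundary j B \<Longrightarrow> B \<subseteq> chars"
  by (simp add: is_boundary_def)

lemma is_boundary_chars:
  assumes "chars \<noteq> {}"
  shows "is_boundary j chars"
  unfolding is_boundary_def using char_attains_max[OF closed_chars order_refl assms]
  by (metis order_refl)

lemma shilov_subset: "chars \<noteq> {} \<Longrightarrow> shilov \<subseteq> chars"
  unfolding shilov_boundary_def closedin_chars_iff using closed_chars is_boundary_chars by blast

definition basic_nbhd :: "'a set \<Rightarrow> ('a \<Rightarrow> complex) set" where
  "basic_nbhd F = {m. \<forall>f\<in>F. cmod (m f) < 1}"

lemma open_basic_nbhd:
  assumes "finite F"
  shows "open (basic_nbhd F)"
proof -
  have "open {m::'a \<Rightarrow> complex. cmod (m f) < 1}" for f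
    by (intro open_Collect_less continuous_intros continuous_on_eval)
  then show ?thesis
    unfolding basic_nbhd_def Collect_ball_eq by (intro open_INT assms ballI)
qed

lemma basic_nbhd_in_open:
  assumes "open W" "m \<in> W"
  obtains F where "finite F" "m \<in> chars \<Longrightarrow> m \<in> basic_nbhd F" "chars \<inter> basic_nbhd F \<subseteq> W"
proof -
  have "openin (product_topology (\<lambda>i. euclidean) UNIV) W"
    using assms by (simp add: euclidean_product_topology)
  then obtain X where box: "m \<in> PiE UNIV X" "\<And>i. open (X i)" "finite {i. X i \<noteq> UNIV}" "PiE UNIV X \<subseteq> W"
    using product_topology_open_contains_basis[of "\<lambda>i. euclidean" UNIV W m] assms by auto
  have "\<exists>e>0. ball (m i) e \<subseteq> X i" for i
    using box(1,2) by (meson PiE_mem UNIV_I open_contains_ball)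
  then obtain e where radii: "\<And>i. e i > 0" "\<And>i. ball (m i) (e i) \<subseteq> X i"
    by metis
  define u where "u i = emb (of_real (1 / e i)) * (i - emb (m i))" for i
  have eval: "cmod (m' (u i)) < 1 \<longleftrightarrow> m' i \<in> ball (m i) (e i)" if "m' \<in> chars" for m' i
  proof -
    have "m' (u i) = of_real (1 / e i) * (m' i - m i)"
      using that by (simp add: u_def char_emb_mult char_diff char_emb)
    then show ?thesis
      using radii(1)[of i] by (simp add: dist_norm norm_minus_commute norm_divide divide_less_eq)
  qed
  show ?thesis
  proof
    show "finite (u ` {i. X i \<noteq> UNIV})"
      using box(3) by simp
    show "m \<in> basic_nbhd (u ` {i. X i \<noteq> UNIV})" if "m \<in> chars"
      using eval[OF that] radii(1) by (simp add: basic_nbhd_def)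
    show "chars \<inter> basic_nbhd (u ` {i. X i \<noteq> UNIV}) \<subseteq> W"
    proof
      fix m' assume m': "m' \<in> chars \<inter> basic_nbhd (u ` {i. X i \<noteq> UNIV})"
      have "m' i \<in> X i" for i
        using m' eval[of m' i] radii(2)[of i] by (cases "X i = UNIV") (auto simp: basic_nbhd_def)
      then show "m' \<in> W"
        using box(4) by auto
    qed
  qed
qed

lemma peak_outside_nonboundary:
  assumes nonboundary: "closed K" "K \<subseteq> chars" "\<not> is_boundary j K" and "chars \<noteq> {}" "\<epsilon> > 0"
  obtains f where "\<And>m. m \<in> chars \<Longrightarrow> cmod (m f) \<le> 1" "\<exists>m\<in>chars. cmod (m f) = 1"
    "\<And>m. m \<in> K \<Longrightarrow> cmod (m f) < \<epsilon>"
proof (cases "K = {}")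
  case True
  then show ?thesis
    using \<open>chars \<noteq> {}\<close> by (intro that[of 1]) (auto simp: char_1)
next
  case False
  obtain f where exceeded: "\<And>m. m \<in> K \<Longrightarrow> \<exists>m'\<in>chars. cmod (m f) < cmod (m' f)"
    using nonboundary by (auto simp: is_boundary_def not_le)
  obtain e where max_on_chars: "e \<in> chars" "\<And>m. m \<in> chars \<Longrightarrow> cmod (m f) \<le> cmod (e f)"
    using char_attains_max[OF closed_chars order_refl \<open>chars \<noteq> {}\<close>] by blast
  obtain k where max_on_K: "k \<in> K" "\<And>m. m \<in> K \<Longrightarrow> cmod (m f) \<le> cmod (k f)"
    using char_attains_max[OF nonboundary(1,2) False] by blast
  define s \<theta> where "s = cmod (e f)" and "\<theta> = cmod (k f) / s"
  have "cmod (k f) < s"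
    using exceeded[OF max_on_K(1)] max_on_chars(2) unfolding s_def by (blast intro: less_le_trans)
  then have s_pos: "s > 0"
    by (rule le_less_trans[OF norm_ge_zero])
  then have "\<theta> < 1"
    using \<open>cmod (k f) < s\<close> by (simp add: \<theta>_def)
  then obtain n where small_power: "\<theta> ^ n < \<epsilon>"
    using real_arch_pow_inv[OF \<open>\<epsilon> > 0\<close>] by blast
  define g where "g = (emb (of_real (1 / s)) * f) ^ n"
  have norm_g: "cmod (m g) = (cmod (m f) / s) ^ n" if "m \<in> chars" for m
    using s_pos by (simp add: g_def char_power[OF that] char_emb_mult[OF that] norm_power norm_divide)
  show ?thesis
  proof
    show "cmod (m g) \<le> 1" if "m \<in> chars" for m
      using max_on_chars(2)[OF that] s_pos by (simp add: norm_g[OF that] s_def power_le_one)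
    show "\<exists>m\<in>chars. cmod (m g) = 1"
      using max_on_chars(1) s_pos by (intro bexI[of _ e]) (simp_all add: norm_g s_def)
    show "cmod (m g) < \<epsilon>" if "m \<in> K" for m
    proof -
      have "cmod (m g) \<le> \<theta> ^ n"
        using that max_on_K(2)[OF that] nonboundary(2) s_pos
        by (subst norm_g) (auto simp: \<theta>_def intro!: power_mono divide_right_mono)
      with small_power show ?thesis by simp
    qed
  qed
qed

lemma char_less_1_if_product_less_1_on_boundary:
  assumes "is_boundary j E" "\<And>m. m \<in> E \<Longrightarrow> cmod (m (f * u)) < 1"
    and b_char: "b \<in> chars" "1 \<le> cmod (b f)"
  shows "cmod (b u) < 1"
proof -
  have "cmod (b u) \<le> cmod (b f) * cmod (b u)"
    using b_char(2) mult_right_mono[of 1 "cmod (b f)" "cmod (b u)"] by simp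
  also have "\<dots> = cmod (b (f * u))"
    by (simp add: char_mult[OF b_char(1)] norm_mult)
  also have "\<dots> < 1"
    using boundary_max[OF assms(1), of "f * u"] assms(2) b_char(1) by (metis le_less_trans)
  finally show ?thesis .
qed

text \<open>This dichotomy for basic neighbourhoods is the key to H. S. Bear's proof of the existence
  of the Shilov boundary.\<close>

lemma is_boundary_minus_basic_nbhd:
  assumes finite_F: "finite F" and boundary_B: "is_boundary j B" "B \<inter> basic_nbhd F = {}"
    and boundary_E: "is_boundary j E" "closed E"
  shows "is_boundary j (E - basic_nbhd F)"
proof (rule ccontr)
  assume not_boundary: "\<not> ?thesis"
  define C where "C = 1 + (\<Sum>u\<in>F. norm u)"
  have C_bound: "C > 0" "\<And>u. u \<in> F \<Longrightarrow> norm u \<le> C"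
    using finite_F member_le_sum[of _ F norm] by (force simp: C_def intro!: add_pos_nonneg sum_nonneg)+
  have "closed (E - basic_nbhd F)" "E - basic_nbhd F \<subseteq> chars" "chars \<noteq> {}"
    using boundary_E finite_F boundary_subset[OF boundary_E(1)] boundary_max[OF boundary_E(1), of 1]
    by (auto simp: closed_Diff open_basic_nbhd)
  then obtain f where peak: "\<And>m. m \<in> chars \<Longrightarrow> cmod (m f) \<le> 1" "\<exists>m\<in>chars. cmod (m f) = 1"
      "\<And>m. m \<in> E - basic_nbhd F \<Longrightarrow> cmod (m f) < 1 / C"
    using peak_outside_nonboundary not_boundary \<open>C > 0\<close> by (metis zero_less_divide_1_iff)
  have product_less_1: "cmod (m (f * u)) < 1" if m_in_E: "m \<in> E" and u_in_F: "u \<in> F" for m u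
  proof -
    have m_char: "m \<in> chars"
      using m_in_E boundary_subset[OF boundary_E(1)] by blast
    have "cmod (m f) * cmod (m u) < 1"
    proof (cases "m \<in> basic_nbhd F")
      case True
      then have "cmod (m u) < 1"
        using u_in_F by (simp add: basic_nbhd_def)
      then show ?thesis
        using mult_right_mono[OF peak(1)[OF m_char], of "cmod (m u)"] by simp
    next
      case False
      have "cmod (m f) * cmod (m u) \<le> cmod (m f) * C"
        using order_trans[OF char_le_norm[OF m_char] C_bound(2)[OF u_in_F]]
        by (intro mult_left_mono) auto
      also have "\<dots> < 1"
        using peak(3)[of m] m_in_E False C_bound(1) by (simp add: less_divide_eq)
      finally show ?thesis .
    qed
    then show ?thesis
      by (simp add: char_mult[OF m_char] norm_mult)
  qed
  obtain b where b_max: "b \<in> B" "\<And>m. m \<in> chars \<Longrightarrow> cmod (m f) \<le> cmod (b f)"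
    using boundary_max[OF boundary_B(1)] by blast
  have "b \<in> chars"
    using b_max boundary_subset[OF boundary_B(1)] by blast
  moreover have "1 \<le> cmod (b f)"
    using peak(2) b_max(2) by metis
  ultimately have "cmod (b u) < 1" if "u \<in> F" for u
    using char_less_1_if_product_less_1_on_boundary[OF boundary_E(1), of f u b]
      product_less_1[OF _ that] by blast
  then show False
    using b_max(1) boundary_B(2) by (auto simp: basic_nbhd_def)
qed

lemma is_boundary_minus_UN_basic_nbhds:
  assumes "finite D" "chars \<noteq> {}"
    and finite_F: "\<And>m. m \<in> D \<Longrightarrow> finite (F m)"
    and missed: "\<And>m. m \<in> D \<Longrightarrow> \<exists>B. is_boundary j B \<and> B \<inter> basic_nbhd (F m) = {}"
  shows "is_boundary j (chars - (\<Union>m\<in>D. basic_nbhd (F m)))"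
  using \<open>finite D\<close> finite_F missed
proof (induction D rule: finite_induct)
  case empty
  then show ?case
    using is_boundary_chars[OF assms(2)] by simp
next
  case (insert m D)
  have "closed (chars - (\<Union>m\<in>D. basic_nbhd (F m)))"
    using insert.prems(1) by (intro closed_Diff closed_chars open_UN) (auto intro: open_basic_nbhd)
  moreover have "is_boundary j (chars - (\<Union>m\<in>D. basic_nbhd (F m)))"
    using insert by simp
  ultimately have "is_boundary j ((chars - (\<Union>m\<in>D. basic_nbhd (F m))) - basic_nbhd (F m))"
    using insert.prems is_boundary_minus_basic_nbhd[of "F m"] by (metis insertI1)
  then show ?case
    by (simp add: Diff_Diff_Int Diff_eq Int_ac)
qed

lemma notin_shilov_obtains_basic_nbhd:
  assumes "m \<in> chars" "m \<notin> shilov"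
  obtains F B where "finite F" "m \<in> basic_nbhd F" "is_boundary j B" "B \<inter> basic_nbhd F = {}"
proof -
  obtain B where boundary_B: "is_boundary j B" "closed B" "m \<notin> B"
    using assms(2) unfolding shilov_boundary_def closedin_chars_iff by blast
  then obtain F where "finite F" "m \<in> basic_nbhd F" "chars \<inter> basic_nbhd F \<subseteq> - B"
    using basic_nbhd_in_open[of "- B" m] assms(1) by (metis ComplI open_Compl)
  then show ?thesis
    using that boundary_B boundary_subset[OF boundary_B(1)] by blast
qed

theorem is_boundary_shilov:
  assumes nonempty: "chars \<noteq> {}"
  shows "is_boundary j shilov"
proof (rule ccontr)
  assume "\<not> ?thesis"
  then obtain f where exceeded: "\<And>m. m \<in> shilov \<Longrightarrow> \<exists>m'\<in>chars. cmod (m f) < cmod (m' f)"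
    using shilov_subset[OF nonempty] by (auto simp: is_boundary_def not_le)
  obtain s where s_max: "s \<in> chars" "\<And>m. m \<in> chars \<Longrightarrow> cmod (m f) \<le> cmod (s f)"
    using boundary_max[OF is_boundary_chars[OF nonempty]] by blast
  define K where "K = {m \<in> chars. cmod (m f) = cmod (s f)}"
  have "closed K"
    unfolding K_def using closed_chars
    by (intro closed_Collect_conj closed_Collect_eq continuous_intros continuous_on_eval) simp
  then have "compact K"
    by (rule compact_if_closed_subset_chars) (simp add: K_def)
  have "m \<notin> shilov" if "m \<in> K" for m
    using exceeded[of m] s_max(2) that by (force simp: K_def)
  then have "\<exists>F. finite F \<and> m \<in> basic_nbhd F \<and> (\<exists>B. is_boundary j B \<and> B \<inter> basic_nbhd F = {})"
    if "m \<in> K" for m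
    using that notin_shilov_obtains_basic_nbhd[of m]
    by (metis (no_types, lifting) K_def mem_Collect_eq)
  then obtain F where nbhds: "\<And>m. m \<in> K \<Longrightarrow> finite (F m)" "\<And>m. m \<in> K \<Longrightarrow> m \<in> basic_nbhd (F m)"
    "\<And>m. m \<in> K \<Longrightarrow> \<exists>B. is_boundary j B \<and> B \<inter> basic_nbhd (F m) = {}"
    by metis
  obtain D where subcover: "D \<subseteq> K" "finite D" "K \<subseteq> (\<Union>m\<in>D. basic_nbhd (F m))"
    by (rule compactE_image[OF \<open>compact K\<close>, of K "\<lambda>m. basic_nbhd (F m)"])
      (use nbhds in \<open>auto intro: open_basic_nbhd\<close>)
  then have "is_boundary j (chars - (\<Union>m\<in>D. basic_nbhd (F m)))"
    using nbhds by (intro is_boundary_minus_UN_basic_nbhds nonempty) auto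
  then obtain b where b_max: "b \<in> chars - (\<Union>m\<in>D. basic_nbhd (F m))" "cmod (s f) \<le> cmod (b f)"
    using boundary_max[of _ f] s_max(1) by metis
  then have "b \<in> K"
    using s_max(2)[of b] by (auto simp: K_def)
  then show False
    using b_max subcover by blast
qed

subsection \<open>Automorphisms\<close>

lemma
  assumes "algebra_automorphism j U"
  shows automorphism_inv_cancel: "U (inv U x) = x" "inv U (U x) = x"
  using assms by (auto simp: algebra_automorphism_def bij_is_inj bij_is_surj surj_f_inv_f)

lemma automorphism_inv:
  assumes automorphism: "algebra_automorphism j U"
  shows "algebra_automorphism j (inv U)"
proof -
  have inv_eqI: "inv U y = x" if "U x = y" for x y
    using that automorphism_inv_cancel[OF automorphism] by auto
  show ?thesis
    using automorphism unfolding algebra_automorphism_def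
    by (auto intro!: bij_imp_bij_inv inv_eqI simp: automorphism_inv_cancel[OF automorphism])
qed

lemma char_comp_automorphism:
  assumes "algebra_automorphism j U" "m \<in> chars"
  shows "m \<circ> U \<in> chars"
  using assms by (auto simp: max_ideal_space_def algebra_automorphism_def)

lemma is_boundary_vimage_automorphism:
  assumes automorphism: "algebra_automorphism j U" and boundary_B: "is_boundary j B"
  shows "is_boundary j {m \<in> chars. m \<circ> U \<in> B}"
  unfolding is_boundary_def
proof (intro conjI allI)
  fix f
  obtain b where b_max: "b \<in> B" "\<And>m. m \<in> chars \<Longrightarrow> cmod (m (inv U f)) \<le> cmod (b (inv U f))"
    using boundary_max[OF boundary_B] by blast
  show "\<exists>m\<in>{m \<in> chars. m \<circ> U \<in> B}. \<forall>m'\<in>chars. cmod (m' f) \<le> cmod (m f)"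
  proof (intro bexI ballI)
    show "b \<circ> inv U \<in> {m \<in> chars. m \<circ> U \<in> B}"
      using b_max(1) boundary_subset[OF boundary_B]
        char_comp_automorphism[OF automorphism_inv[OF automorphism]]
      by (auto simp: o_def automorphism_inv_cancel[OF automorphism])
    show "cmod (m' f) \<le> cmod ((b \<circ> inv U) f)" if "m' \<in> chars" for m'
      using b_max(2)[OF char_comp_automorphism[OF automorphism that]]
      by (simp add: automorphism_inv_cancel[OF automorphism])
  qed
qed simp

lemma shilov_comp_automorphism:
  assumes automorphism: "algebra_automorphism j U" and t_shilov: "t \<in> shilov"
  shows "t \<circ> U \<in> shilov"
proof -
  have "t \<circ> U \<in> B" if boundary_B: "is_boundary j B" "closed B" for B
  proof -
    have "continuous_on UNIV (\<lambda>m::'a \<Rightarrow> complex. m \<circ> U)"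
      by (intro continuous_on_coordinatewise_then_product) simp
    then have "closed (chars \<inter> (\<lambda>m. m \<circ> U) -` B)"
      using boundary_B(2) closed_chars by (intro closed_Int closed_vimage)
    then have "t \<in> {m \<in> chars. m \<circ> U \<in> B}"
      using t_shilov is_boundary_vimage_automorphism[OF automorphism boundary_B(1)]
      unfolding shilov_boundary_def closedin_chars_iff by (auto simp: vimage_def Int_def)
    then show ?thesis
      by simp
  qed
  then show ?thesis
    by (simp add: shilov_boundary_def closedin_chars_iff)
qed

text \<open>The separating continuous functionals \<open>m\<close> and \<open>m \<circ> U\<close> give \<open>U\<close> a closed graph.\<close>

lemma bounded_linear_automorphism:
  assumes "semisimple TYPE('a)" and automorphism: "algebra_automorphism j U"
  shows "bounded_linear U"
proof (rule closed_graph_bounded_linear)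
  show "linear U"
  proof (rule linearI)
    show "U (r *\<^sub>R x) = r *\<^sub>R U x" for r x
      using automorphism unfolding algebra_automorphism_def cscale_eq
      by (metis emb_of_real scaleR_conv_of_real)
  qed (use automorphism in \<open>simp add: algebra_automorphism_def\<close>)
  fix X x y
  assume X_tendsto: "X \<longlonglongrightarrow> x" and UX_tendsto: "(\<lambda>n. U (X n)) \<longlonglongrightarrow> y"
  have "m (U x - y) = 0" if m_char: "m \<in> chars" for m
  proof -
    have "(\<lambda>n. m (U (X n))) \<longlonglongrightarrow> m y"
      by (rule bounded_linear.tendsto[OF bounded_linear_char[OF m_char] UX_tendsto])
    moreover have "(\<lambda>n. m (U (X n))) \<longlonglongrightarrow> m (U x)"
      using bounded_linear.tendsto[OF bounded_linear_char X_tendsto]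
        char_comp_automorphism[OF automorphism m_char] by fastforce
    ultimately have "m (U x) = m y"
      using LIMSEQ_unique by blast
    then show ?thesis
      by (simp add: char_diff[OF m_char])
  qed
  then have "U x - y = 0"
    by (rule chars_separate[OF assms(1)])
  then show "U x = y"
    by simp
qed

end

section \<open>Operators on spaces of bounded functions\<close>

locale bounded_function_space =
  fixes C :: "('x \<Rightarrow> complex) set" and D :: "'x set"
  assumes domain_nonempty: "D \<noteq> {}"
    and linear_combination: "\<lbrakk>g \<in> C; h \<in> C\<rbrakk> \<Longrightarrow> (\<lambda>t. a * g t + b * h t) \<in> C"
    and bounded: "g \<in> C \<Longrightarrow> bdd_above ((\<lambda>t. cmod (g t)) ` D)"
begin

definition sup_norm :: "('x \<Rightarrow> complex) \<Rightarrow> real" where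
  "sup_norm g = (SUP t\<in>D. cmod (g t))"

definition bounded_map :: "(('x \<Rightarrow> complex) \<Rightarrow> ('x \<Rightarrow> complex)) \<Rightarrow> bool" where
  "bounded_map L \<longleftrightarrow> (\<forall>g\<in>C. L g \<in> C) \<and> (\<exists>K. \<forall>g\<in>C. sup_norm (L g) \<le> K * sup_norm g)"

definition linear_map :: "(('x \<Rightarrow> complex) \<Rightarrow> ('x \<Rightarrow> complex)) \<Rightarrow> bool" where
  "linear_map L \<longleftrightarrow> (\<forall>g\<in>C. \<forall>h\<in>C. \<forall>a b. L (\<lambda>t. a * g t + b * h t) = (\<lambda>t. a * L g t + b * L h t))"

definition bounded_inverse ::
  "(('x \<Rightarrow> complex) \<Rightarrow> ('x \<Rightarrow> complex)) \<Rightarrow> (('x \<Rightarrow> complex) \<Rightarrow> ('x \<Rightarrow> complex)) \<Rightarrow> bool" where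
  "bounded_inverse L S \<longleftrightarrow> bounded_map S \<and> (\<forall>g\<in>C. S (L g) = g) \<and> (\<forall>g\<in>C. L (S g) = g)"

lemma norm_le_sup_norm: "g \<in> C \<Longrightarrow> t \<in> D \<Longrightarrow> cmod (g t) \<le> sup_norm g"
  unfolding sup_norm_def by (intro cSUP_upper bounded)

lemma sup_norm_leI: "(\<And>t. t \<in> D \<Longrightarrow> cmod (g t) \<le> b) \<Longrightarrow> sup_norm g \<le> b"
  unfolding sup_norm_def using domain_nonempty by (rule cSUP_least)

lemma sup_norm_nonneg: "g \<in> C \<Longrightarrow> 0 \<le> sup_norm g"
  using domain_nonempty norm_le_sup_norm[of g] by (meson all_not_in_conv norm_ge_zero order_trans)

lemma sup_norm_cmult_le: "g \<in> C \<Longrightarrow> sup_norm (\<lambda>t. a * g t) \<le> cmod a * sup_norm g"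
  by (rule sup_norm_leI) (simp add: norm_mult mult_left_mono norm_le_sup_norm)

lemma diff_in: "g \<in> C \<Longrightarrow> h \<in> C \<Longrightarrow> (\<lambda>t. g t - h t) \<in> C"
  using linear_combination[of g h 1 "- 1"] by simp

lemma cmult_in: "g \<in> C \<Longrightarrow> (\<lambda>t. a * g t) \<in> C"
  using linear_combination[of g g a 0] by simp

lemma sup_norm_le_add_diff:
  assumes "g \<in> C" "h \<in> C"
  shows "sup_norm g \<le> sup_norm h + sup_norm (\<lambda>t. g t - h t)"
proof (rule sup_norm_leI)
  fix t assume t_in_D: "t \<in> D"
  have "cmod (h t) + cmod (g t - h t) \<le> sup_norm h + sup_norm (\<lambda>t. g t - h t)"
    using norm_le_sup_norm[OF assms(2) t_in_D] norm_le_sup_norm[OF diff_in[OF assms] t_in_D]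
    by (rule add_mono)
  then show "cmod (g t) \<le> sup_norm h + sup_norm (\<lambda>t. g t - h t)"
    using norm_triangle_ineq[of "h t" "g t - h t"] by simp
qed

lemma bounded_map_in: "bounded_map L \<Longrightarrow> g \<in> C \<Longrightarrow> L g \<in> C"
  by (simp add: bounded_map_def)

lemma bounded_map_nonneg_bound:
  assumes "bounded_map L"
  obtains K where "K \<ge> 0" "\<And>g. g \<in> C \<Longrightarrow> sup_norm (L g) \<le> K * sup_norm g"
proof -
  obtain K where L_bound: "\<And>g. g \<in> C \<Longrightarrow> sup_norm (L g) \<le> K * sup_norm g"
    using assms unfolding bounded_map_def by blast
  show ?thesis
  proof
    show "sup_norm (L g) \<le> max K 0 * sup_norm g" if "g \<in> C" for g
      using L_bound[OF that] mult_right_mono[OF max.cobounded1 sup_norm_nonneg[OF that], of K 0] by simp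
  qed simp
qed

lemma bounded_map_id: "bounded_map id" and linear_map_id: "linear_map id"
  by (auto simp: bounded_map_def linear_map_def intro: exI[of _ 1])

lemma bounded_inverse_scale:
  assumes S_inverse: "bounded_inverse L S" and "a \<noteq> 0"
  shows "bounded_inverse (\<lambda>g t. a * L g t) (\<lambda>g. S (\<lambda>t. inverse a * g t))"
proof -
  obtain K where S_bound: "K \<ge> 0" "\<And>g. g \<in> C \<Longrightarrow> sup_norm (S g) \<le> K * sup_norm g"
    using S_inverse bounded_map_nonneg_bound unfolding bounded_inverse_def by metis
  have "sup_norm (S (\<lambda>t. inverse a * g t)) \<le> K * cmod (inverse a) * sup_norm g" if "g \<in> C" for g
    using order_trans[OF S_bound(2)[OF cmult_in] mult_left_mono[OF sup_norm_cmult_le \<open>K \<ge> 0\<close>]] that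
    by (simp add: mult.assoc)
  then show ?thesis
    using assms cmult_in[of _ "inverse a"] unfolding bounded_inverse_def bounded_map_def
    by (auto simp: fun_eq_iff simp flip: mult.assoc)
qed

lemma linear_map_bounded_inverse:
  assumes "linear_map L" "bounded_inverse L S"
  shows "linear_map S"
  unfolding linear_map_def
proof (intro ballI allI)
  fix g h a b assume gh_in: "g \<in> C" "h \<in> C"
  have S_in: "S g \<in> C" "S h \<in> C"
    using assms(2) gh_in by (auto simp: bounded_inverse_def bounded_map_def)
  then have "L (\<lambda>t. a * S g t + b * S h t) = (\<lambda>t. a * g t + b * h t)"
    using assms gh_in by (simp add: bounded_inverse_def linear_map_def)
  then show "S (\<lambda>t. a * g t + b * h t) = (\<lambda>t. a * S g t + b * S h t)"
    using assms(2) linear_combination[OF S_in, of a b] by (metis bounded_inverse_def)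
qed

end

locale function_pencil = bounded_function_space C D
  for C :: "('x \<Rightarrow> complex) set" and D +
  fixes X Y :: "('x \<Rightarrow> complex) \<Rightarrow> ('x \<Rightarrow> complex)"
  assumes linear_X: "linear_map X" and linear_Y: "linear_map Y" and bounded_Y: "bounded_map Y"
begin

definition function_pencil :: "complex \<Rightarrow> ('x \<Rightarrow> complex) \<Rightarrow> ('x \<Rightarrow> complex)" where
  "function_pencil c g = (\<lambda>t. X g t - c * Y g t)"

lemma linear_map_function_pencil: "linear_map (function_pencil c)"
  using linear_X linear_Y by (simp add: linear_map_def function_pencil_def algebra_simps)

lemma function_resolvent_identity:
  assumes inverse_c: "bounded_inverse (function_pencil c) S"
    and inverse_d: "bounded_inverse (function_pencil d) S'"
    and g_in: "g \<in> C"
  shows "S g t - S' g t = (c - d) * S' (Y (S g)) t"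
proof -
  have Sg_in: "S g \<in> C" "Y (S g) \<in> C"
    using inverse_c g_in bounded_Y by (auto simp: bounded_inverse_def bounded_map_def)
  have "function_pencil c (S g) = g"
    using inverse_c g_in by (simp add: bounded_inverse_def)
  then have "function_pencil d (S g) = (\<lambda>t. 1 * g t + (c - d) * Y (S g) t)"
    by (auto simp: function_pencil_def fun_eq_iff algebra_simps)
  then have "S g = S' (\<lambda>t. 1 * g t + (c - d) * Y (S g) t)"
    using inverse_d Sg_in by (metis bounded_inverse_def)
  also have "\<dots> = (\<lambda>t. 1 * S' g t + (c - d) * S' (Y (S g)) t)"
    using linear_map_bounded_inverse[OF linear_map_function_pencil inverse_d] g_in Sg_in
    unfolding linear_map_def by blast
  finally show ?thesis
    by (simp add: fun_eq_iff)
qed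

context
  fixes \<Omega> :: "complex set" and S :: "complex \<Rightarrow> ('x \<Rightarrow> complex) \<Rightarrow> ('x \<Rightarrow> complex)"
  assumes S_inverse: "c \<in> \<Omega> \<Longrightarrow> bounded_inverse (function_pencil c) (S c)"
begin

lemma function_resolvent_in: "c \<in> \<Omega> \<Longrightarrow> g \<in> C \<Longrightarrow> S c g \<in> C"
  using S_inverse by (auto simp: bounded_inverse_def bounded_map_def)

lemma sup_norm_function_resolvent_diff_le:
  assumes d_in: "d \<in> \<Omega>" and g_in: "g \<in> C"
  obtains K where "K \<ge> 0"
    "\<And>c. c \<in> \<Omega> \<Longrightarrow> sup_norm (\<lambda>t. S c g t - S d g t) \<le> dist c d * K * sup_norm (S c g)"
proof -
  obtain K where S_bound: "K \<ge> 0" "\<And>g. g \<in> C \<Longrightarrow> sup_norm (S d g) \<le> K * sup_norm g"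
    using S_inverse[OF d_in] bounded_map_nonneg_bound unfolding bounded_inverse_def by metis
  obtain M where Y_bound: "M \<ge> 0" "\<And>g. g \<in> C \<Longrightarrow> sup_norm (Y g) \<le> M * sup_norm g"
    using bounded_map_nonneg_bound[OF bounded_Y] by metis
  have "sup_norm (\<lambda>t. S c g t - S d g t) \<le> dist c d * (K * M) * sup_norm (S c g)"
    if c_in: "c \<in> \<Omega>" for c
  proof -
    have YS_in: "Y (S c g) \<in> C"
      using bounded_map_in[OF bounded_Y function_resolvent_in[OF c_in g_in]] .
    have "sup_norm (\<lambda>t. S c g t - S d g t) = sup_norm (\<lambda>t. (c - d) * S d (Y (S c g)) t)"
      using function_resolvent_identity[OF S_inverse[OF c_in] S_inverse[OF d_in] g_in] by simp
    also have "\<dots> \<le> cmod (c - d) * sup_norm (S d (Y (S c g)))"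
      by (intro sup_norm_cmult_le function_resolvent_in d_in YS_in)
    also have "\<dots> \<le> cmod (c - d) * (K * (M * sup_norm (S c g)))"
      using order_trans[OF S_bound(2)[OF YS_in] mult_left_mono[OF Y_bound(2) S_bound(1)]]
        function_resolvent_in[OF c_in g_in] by (intro mult_left_mono) auto
    finally show ?thesis
      by (simp add: dist_norm mult_ac)
  qed
  with S_bound(1) Y_bound(1) show thesis
    by (intro that[of "K * M"]) auto
qed

lemma tendsto_function_resolvent:
  assumes d_in: "d \<in> \<Omega>" and g_in: "g \<in> C" and t_in_D: "t \<in> D"
  shows "((\<lambda>c. S c g t) \<longlongrightarrow> S d g t) (at d within \<Omega>)"
proof -
  define \<delta> where "\<delta> c = sup_norm (\<lambda>t. S c g t - S d g t)" for c
  obtain K where estimate: "K \<ge> 0" "\<And>c. c \<in> \<Omega> \<Longrightarrow> \<delta> c \<le> dist c d * K * sup_norm (S c g)"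
    using sup_norm_function_resolvent_diff_le[OF d_in g_in] unfolding \<delta>_def by blast
  have tendsto_\<delta>: "(\<delta> \<longlongrightarrow> 0) (at d within \<Omega>)"
    by (rule tendsto_0_if_resolvent_estimate[OF estimate(1) _ estimate(2)])
      (auto simp: \<delta>_def d_in g_in
        intro!: sup_norm_nonneg sup_norm_le_add_diff diff_in function_resolvent_in)
  have "cmod (S c g t - S d g t) \<le> \<delta> c" if "c \<in> \<Omega>" for c
    unfolding \<delta>_def
    using norm_le_sup_norm[OF diff_in t_in_D] function_resolvent_in[OF _ g_in] d_in that by blast
  then have "\<forall>\<^sub>F c in at d within \<Omega>. cmod (S c g t - S d g t) \<le> \<delta> c"
    by (simp add: eventually_at_filter)
  then have "((\<lambda>c. S c g t - S d g t) \<longlongrightarrow> 0) (at d within \<Omega>)"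
    by (rule Lim_null_comparison[OF _ tendsto_\<delta>])
  then show ?thesis
    by (rule LIM_zero_cancel)
qed

lemma holomorphic_on_function_resolvent:
  assumes g_in: "g \<in> C" and t_in_D: "t \<in> D"
  shows "(\<lambda>c. S c g t) holomorphic_on \<Omega>"
proof -
  have "((\<lambda>c. S c g t) has_field_derivative S d (Y (S d g)) t) (at d within \<Omega>)" if d_in: "d \<in> \<Omega>" for d
    unfolding has_field_derivative_iff
  proof (rule Lim_transform_eventually)
    have YS_in: "Y (S d g) \<in> C"
      by (rule bounded_map_in[OF bounded_Y function_resolvent_in[OF d_in g_in]])
    show "((\<lambda>c. S c (Y (S d g)) t) \<longlongrightarrow> S d (Y (S d g)) t) (at d within \<Omega>)"
      by (rule tendsto_function_resolvent[OF d_in YS_in t_in_D])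
    have "S c (Y (S d g)) t = (S c g t - S d g t) / (c - d)" if "c \<in> \<Omega>" "c \<noteq> d" for c
      using function_resolvent_identity[OF S_inverse[OF d_in] S_inverse[OF that(1)] g_in, of t] that(2)
      by (simp add: field_simps)
    then show "\<forall>\<^sub>F c in at d within \<Omega>. S c (Y (S d g)) t = (S c g t - S d g t) / (c - d)"
      by (simp add: eventually_at_filter)
  qed
  then show ?thesis
    unfolding holomorphic_on_def field_differentiable_def by blast
qed

end

end

section \<open>Operator pencils\<close>

locale operator_pencil = complex_banach_algebra +
  fixes X Y :: "'a \<Rightarrow> 'a"
  assumes bounded_linear_X: "bounded_linear X" and bounded_linear_Y: "bounded_linear Y"
begin

definition pencil :: "complex \<Rightarrow> 'a \<Rightarrow> 'a" where
  "pencil c x = X x - emb c * Y x"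

definition regular_set :: "complex set" where
  "regular_set = {c. bij (pencil c)}"

definition resolvent :: "complex \<Rightarrow> 'a \<Rightarrow> 'a" where
  "resolvent c = inv (pencil c)"

lemma bounded_linear_pencil: "bounded_linear (pencil c)"
  unfolding pencil_def
  by (intro bounded_linear_sub bounded_linear_X bounded_linear_const_mult bounded_linear_Y)

lemma bounded_linear_resolvent: "c \<in> regular_set \<Longrightarrow> bounded_linear (resolvent c)"
  unfolding resolvent_def regular_set_def by (auto intro: bounded_linear_inv bounded_linear_pencil)

lemma pencil_resolvent: "c \<in> regular_set \<Longrightarrow> pencil c (resolvent c x) = x"
  and resolvent_pencil: "c \<in> regular_set \<Longrightarrow> resolvent c (pencil c x) = x"
  by (auto simp: regular_set_def resolvent_def bij_is_inj bij_is_surj surj_f_inv_f)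

lemma pencil_diff: "pencil c x - pencil d x = emb (d - c) * Y x"
  by (simp add: pencil_def emb_diff algebra_simps)

lemma open_regular_set: "open regular_set"
  unfolding open_contains_ball
proof
  fix c assume "c \<in> regular_set"
  then obtain \<epsilon> where perturbation: "\<epsilon> > 0"
      "\<And>E. linear E \<Longrightarrow> (\<And>x. norm (E x) \<le> \<epsilon> * norm x) \<Longrightarrow> bij (\<lambda>x. pencil c x - E x)"
    using bij_minus_small_perturbation[OF bounded_linear_pencil, of c]
    unfolding regular_set_def by blast
  obtain K where Y_bound: "K > 0" "\<And>x. norm (Y x) \<le> norm x * K"
    using bounded_linear.pos_bounded[OF bounded_linear_Y] by blast
  have "d \<in> regular_set" if "d \<in> ball c (\<epsilon> / K)" for d
  proof -
    have "bij (\<lambda>x. pencil c x - emb (d - c) * Y x)"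
    proof (rule perturbation(2))
      show "linear (\<lambda>x. emb (d - c) * Y x)"
        by (intro bounded_linear.linear bounded_linear_const_mult bounded_linear_Y)
      have "cmod (d - c) * K \<le> \<epsilon>"
        using that Y_bound(1) by (simp add: dist_norm norm_minus_commute field_simps)
      then show "norm (emb (d - c) * Y x) \<le> \<epsilon> * norm x" for x
        using mult_left_mono[OF Y_bound(2), of "cmod (d - c)" x]
          mult_right_mono[of "cmod (d - c) * K" \<epsilon> "norm x"]
        unfolding norm_emb_mult by (simp add: mult_ac)
    qed
    then show ?thesis
      by (simp add: regular_set_def flip: pencil_diff)
  qed
  then show "\<exists>e>0. ball c e \<subseteq> regular_set"
    using perturbation(1) Y_bound(1) by (intro exI[of _ "\<epsilon> / K"]) auto
qed

lemma resolvent_diff: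
  assumes "c \<in> regular_set" "d \<in> regular_set"
  shows "resolvent c x - resolvent d x = resolvent d (emb (c - d) * Y (resolvent c x))"
proof -
  interpret R: bounded_linear "resolvent d"
    using assms(2) by (rule bounded_linear_resolvent)
  have "pencil d (resolvent c x) = x + emb (c - d) * Y (resolvent c x)"
    using pencil_diff[of d "resolvent c x" c] assms(1) by (simp add: pencil_resolvent algebra_simps)
  then have "resolvent c x = resolvent d x + resolvent d (emb (c - d) * Y (resolvent c x))"
    using assms(2) by (metis resolvent_pencil R.add)
  then show ?thesis
    by (metis add_diff_cancel_left')
qed

lemma continuous_on_resolvent: "continuous_on regular_set (\<lambda>c. resolvent c x)"
  unfolding continuous_on
proof
  fix d assume d_regular: "d \<in> regular_set"
  obtain K where resolvent_bound: "K > 0" "\<And>x. norm (resolvent d x) \<le> norm x * K"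
    using bounded_linear.pos_bounded[OF bounded_linear_resolvent[OF d_regular]] by blast
  obtain M where Y_bound: "M > 0" "\<And>x. norm (Y x) \<le> norm x * M"
    using bounded_linear.pos_bounded[OF bounded_linear_Y] by blast
  have "((\<lambda>c. norm (resolvent c x - resolvent d x)) \<longlongrightarrow> 0) (at d within regular_set)"
  proof (rule tendsto_0_if_resolvent_estimate)
    show "M * K \<ge> 0"
      using resolvent_bound Y_bound by simp
    fix c assume c_regular: "c \<in> regular_set"
    have "norm (resolvent c x - resolvent d x) \<le> cmod (c - d) * norm (Y (resolvent c x)) * K"
      using resolvent_bound(2)[of "emb (c - d) * Y (resolvent c x)"]
      by (simp add: resolvent_diff[OF c_regular d_regular] norm_emb_mult)
    also have "\<dots> \<le> cmod (c - d) * (norm (resolvent c x) * M) * K"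
      using resolvent_bound(1) Y_bound(2) by (intro mult_right_mono mult_left_mono) auto
    finally show "norm (resolvent c x - resolvent d x) \<le> dist c d * (M * K) * norm (resolvent c x)"
      by (simp add: dist_norm mult_ac)
    show "norm (resolvent c x) \<le> norm (resolvent d x) + norm (resolvent c x - resolvent d x)"
      by (rule norm_triangle_sub)
  qed simp_all
  then show "((\<lambda>c. resolvent c x) \<longlongrightarrow> resolvent d x) (at d within regular_set)"
    by (rule LIM_zero_cancel[OF tendsto_norm_zero_cancel])
qed

end

context complex_banach_algebra
begin

lemma continuous_on_emb: "continuous_on A emb"
  unfolding emb_def by (intro continuous_intros)

text \<open>The element \<open>G\<close> is the Cauchy integral of \<open>h\<close> along \<open>p\<close>, evaluated at \<open>z\<close>.\<close>

lemma ex_Cauchy_integral_of_functionals: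
  assumes loop: "polynomial_function p" "pathfinish p = pathstart p" "path_image p \<subseteq> \<Omega>"
    and inside: "z \<in> \<Omega>" "z \<notin> path_image p" "winding_number p z \<noteq> 0"
    and domain: "open \<Omega>" "convex \<Omega>"
    and continuous_h: "continuous_on (path_image p) h"
  obtains G :: 'a where "\<And>t F. \<lbrakk>bounded_linear t; \<And>c x. t (emb c * x) = c * t x; F holomorphic_on \<Omega>;
    \<And>c. c \<in> path_image p \<Longrightarrow> t (h c) = F c\<rbrakk> \<Longrightarrow> t G = F z"
proof -
  obtain p' where derivative: "polynomial_function p'" "\<And>s. (p has_vector_derivative p' s) (at s)"
    using has_vector_derivative_polynomial_function[OF loop(1)] by blast
  have on_path: "p s \<in> path_image p" if "s \<in> {0..1}" for s
    using that by (auto simp: path_image_def)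
  define H where "H s = emb (p' s / (p s - z)) * h (p s)" for s
  have "continuous_on {0..1} H"
    unfolding H_def using loop(1) derivative(1) inside(2) on_path
    by (intro continuous_on_mult continuous_on_compose2[OF continuous_on_emb[of UNIV]]
        continuous_on_compose2[OF continuous_h] continuous_on_divide continuous_on_diff
        continuous_on_const continuous_on_polymonial_function) auto
  then have H_integral: "(H has_integral integral {0..1} H) {0..1}"
    by (intro integrable_integral integrable_continuous_interval)
  define n where "n = 2 * pi * \<i> * winding_number p z"
  have "n \<noteq> 0"
    using inside by (simp add: n_def)
  show thesis
  proof
    fix t :: "'a \<Rightarrow> complex" and F
    assume functional: "bounded_linear t" "\<And>c x. t (emb c * x) = c * t x"
      and holomorphic_F: "F holomorphic_on \<Omega>" "\<And>c. c \<in> path_image p \<Longrightarrow> t (h c) = F c"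
    have "((\<lambda>c. F c / (c - z)) has_contour_integral (2 * pi * \<i> * winding_number p z * F z)) p"
      using loop inside domain holomorphic_F(1)
      by (intro Cauchy_integral_formula_convex_simple[of \<Omega>])
        (auto simp: interior_open valid_path_polynomial_function)
    then have "((\<lambda>s. F (p s) / (p s - z) * p' s) has_integral n * F z) {0..1}"
      by (simp add: has_contour_integral n_def vector_derivative_at[OF derivative(2)])
    moreover have "t (H s) = F (p s) / (p s - z) * p' s" if "s \<in> {0..1}" for s
      using holomorphic_F(2)[OF on_path[OF that]] by (simp add: H_def functional(2))
    ultimately have "((\<lambda>s. t (H s)) has_integral n * F z) {0..1}"
      using has_integral_eq[of "{0..1}" "\<lambda>s. F (p s) / (p s - z) * p' s"] by auto
    moreover have "((\<lambda>s. t (H s)) has_integral t (integral {0..1} H)) {0..1}"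
      using has_integral_linear[OF H_integral functional(1)] by (simp add: o_def)
    ultimately have "t (integral {0..1} H) = n * F z"
      using has_integral_unique by blast
    then show "t (emb (inverse n) * integral {0..1} H) = F z"
      using \<open>n \<noteq> 0\<close> by (simp add: functional(2))
  qed
qed

end

section \<open>Restriction to the Shilov boundary\<close>

locale semisimple_banach_algebra = complex_banach_algebra +
  assumes semisimple: "semisimple TYPE('a)"
begin

lemma shilov_boundary: "is_boundary j shilov"
  using chars_separate[OF semisimple, of 1] by (intro is_boundary_shilov) fastforce

lemma shilov_chars: "t \<in> shilov \<Longrightarrow> t \<in> chars"
  using boundary_subset[OF shilov_boundary] by blast

definition check :: "'a \<Rightarrow> ('a \<Rightarrow> complex) \<Rightarrow> complex" where
  "check f t = (if t \<in> shilov then t f else 0)"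

lemma inj_check: "inj check"
proof (rule injI)
  fix f g assume check_eq: "check f = check g"
  have "f - g = 0"
  proof (rule chars_separate[OF semisimple])
    fix m assume m_char: "m \<in> chars"
    obtain t where t_max: "t \<in> shilov" "cmod (m (f - g)) \<le> cmod (t (f - g))"
      using boundary_max[OF shilov_boundary] m_char by metis
    have "t (f - g) = 0"
      using fun_cong[OF check_eq, of t] t_max(1) shilov_chars by (simp add: check_def char_diff)
    then show "m (f - g) = 0"
      using t_max(2) by simp
  qed
  then show "f = g" by simp
qed

lemma check_in_check_alg: "check f \<in> check_alg j"
  unfolding check_alg_def check_def by (auto intro!: exI[of _ f])

lemma check_alg_outside: "g \<in> check_alg j \<Longrightarrow> t \<notin> shilov \<Longrightarrow> g t = 0"
  by (simp add: check_alg_def)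

lemma check_alg_approx:
  assumes "g \<in> check_alg j" "\<epsilon> > 0"
  obtains f where "\<And>t. t \<in> shilov \<Longrightarrow> cmod (g t - t f) < \<epsilon>"
  using assms unfolding check_alg_def by blast

lemma check_algI:
  assumes outside: "\<And>t. t \<notin> shilov \<Longrightarrow> g t = 0" and "K \<ge> 0"
    and approx: "\<And>\<epsilon>. \<epsilon> > 0 \<Longrightarrow> \<exists>f. \<forall>t\<in>shilov. cmod (g t - t f) \<le> K * \<epsilon>"
  shows "g \<in> check_alg j"
  unfolding check_alg_def
proof (intro CollectI conjI allI impI)
  fix \<epsilon> :: real assume "\<epsilon> > 0"
  then obtain f where "\<forall>t\<in>shilov. cmod (g t - t f) \<le> K * (\<epsilon> / (K + 1))"
    using approx[of "\<epsilon> / (K + 1)"] \<open>K \<ge> 0\<close> by auto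
  moreover have "K * (\<epsilon> / (K + 1)) < \<epsilon>"
    using \<open>\<epsilon> > 0\<close> \<open>K \<ge> 0\<close> by (simp add: field_simps)
  ultimately show "\<exists>f. \<forall>t\<in>shilov. cmod (g t - t f) < \<epsilon>"
    by (meson le_less_trans)
qed (rule outside)

sublocale bounded_function_space "check_alg j" shilov
proof
  show "shilov \<noteq> {}"
    using boundary_max[OF shilov_boundary] by blast
  fix g h a b assume g_in: "g \<in> check_alg j" and h_in: "h \<in> check_alg j"
  show "(\<lambda>t. a * g t + b * h t) \<in> check_alg j"
  proof (rule check_algI[where K = "cmod a + cmod b"])
    fix \<epsilon> :: real assume "\<epsilon> > 0"
    obtain f where f_approx: "\<And>t. t \<in> shilov \<Longrightarrow> cmod (g t - t f) < \<epsilon>"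
      using check_alg_approx[OF g_in \<open>\<epsilon> > 0\<close>] by blast
    obtain k where k_approx: "\<And>t. t \<in> shilov \<Longrightarrow> cmod (h t - t k) < \<epsilon>"
      using check_alg_approx[OF h_in \<open>\<epsilon> > 0\<close>] by blast
    have "cmod (a * g t + b * h t - t (emb a * f + emb b * k)) \<le> (cmod a + cmod b) * \<epsilon>"
      if t_shilov: "t \<in> shilov" for t
    proof -
      have "a * g t + b * h t - t (emb a * f + emb b * k) = a * (g t - t f) + b * (h t - t k)"
        by (simp add: char_add char_emb_mult shilov_chars[OF t_shilov] right_diff_distrib)
      also have "cmod \<dots> \<le> cmod a * cmod (g t - t f) + cmod b * cmod (h t - t k)"
        by (metis norm_mult norm_triangle_ineq)
      also have "\<dots> \<le> cmod a * \<epsilon> + cmod b * \<epsilon>"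
        using f_approx[OF t_shilov] k_approx[OF t_shilov] by (intro add_mono mult_left_mono) auto
      finally show ?thesis
        by (simp add: distrib_right)
    qed
    then show "\<exists>f. \<forall>t\<in>shilov. cmod (a * g t + b * h t - t f) \<le> (cmod a + cmod b) * \<epsilon>"
      by blast
  qed (use g_in h_in in \<open>auto simp: check_alg_outside\<close>)
next
  fix g assume "g \<in> check_alg j"
  then obtain f where f_approx: "\<And>t. t \<in> shilov \<Longrightarrow> cmod (g t - t f) < 1"
    using check_alg_approx[of g 1] by auto
  have "cmod (g t) \<le> 1 + norm f" if t_shilov: "t \<in> shilov" for t
    using f_approx[OF t_shilov] char_le_norm[OF shilov_chars[OF t_shilov], of f]
      norm_triangle_ineq2[of "g t" "t f"] by simp
  then show "bdd_above ((\<lambda>t. cmod (g t)) ` shilov)"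
    by (rule bdd_aboveI2)
qed

end

locale restricted_pencil = semisimple_banach_algebra + operator_pencil +
  check: function_pencil "check_alg j" shilov Xc Yc for Xc Yc +
  assumes check_X: "check (X f) = Xc (check f)" and check_Y: "check (Y f) = Yc (check f)"
begin

lemma check_pencil: "check (pencil c f) = check.function_pencil c (check f)"
proof
  fix t
  show "check (pencil c f) t = check.function_pencil c (check f) t"
    using shilov_chars[of t]
    by (auto simp: check.function_pencil_def check_def pencil_def char_diff char_emb_mult
        simp flip: check_X check_Y)
qed

text \<open>The restriction of the resolvent along \<open>p\<close> extends holomorphically to \<open>\<Omega>\<close>.\<close>

lemma ex_pencil_preimage_inside_loop:
  assumes domain: "open \<Omega>" "convex \<Omega>"
    and S_inverse: "\<And>c. c \<in> \<Omega> \<Longrightarrow> bounded_inverse (check.function_pencil c) (S c)"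
    and loop: "polynomial_function p" "pathfinish p = pathstart p" "path_image p \<subseteq> \<Omega> \<inter> regular_set"
    and inside: "z \<in> \<Omega>" "z \<notin> path_image p" "winding_number p z \<noteq> 0"
  shows "\<exists>G. pencil z G = f"
proof -
  have "continuous_on (path_image p) (\<lambda>c. resolvent c f)"
    using loop(3) by (intro continuous_on_subset[OF continuous_on_resolvent]) auto
  then obtain G where Cauchy_integral: "\<And>t F. \<lbrakk>bounded_linear t;
      \<And>c x. t (emb c * x) = c * t x; F holomorphic_on \<Omega>;
      \<And>c. c \<in> path_image p \<Longrightarrow> t (resolvent c f) = F c\<rbrakk> \<Longrightarrow> t G = F z"
    using ex_Cauchy_integral_of_functionals[OF loop(1,2) _ inside domain] loop(3) by (metis le_inf_iff)
  have "S c (check f) = check (resolvent c f)" if "c \<in> path_image p" for c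
  proof -
    have on_path: "c \<in> \<Omega>" "c \<in> regular_set"
      using that loop(3) by auto
    have "S c (check.function_pencil c (check (resolvent c f))) = check (resolvent c f)"
      using S_inverse[OF on_path(1)] check_in_check_alg by (simp add: bounded_inverse_def)
    then show ?thesis
      using pencil_resolvent[OF on_path(2)] by (simp flip: check_pencil)
  qed
  then have "t G = S z (check f) t" if "t \<in> shilov" for t
    using that shilov_chars[OF that]
      check.holomorphic_on_function_resolvent[OF S_inverse check_in_check_alg]
    by (intro Cauchy_integral[of t "\<lambda>c. S c (check f) t"] bounded_linear_char)
      (auto simp: char_emb_mult check_def)
  moreover have "S z (check f) t = 0" if "t \<notin> shilov" for t
    using check_alg_outside[OF _ that] check.function_resolvent_in[OF S_inverse inside(1)]
      check_in_check_alg by blast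
  ultimately have "check G = S z (check f)"
    by (auto simp: check_def)
  then have "check (pencil z G) = check f"
    using S_inverse[OF inside(1)] check_in_check_alg by (simp add: check_pencil bounded_inverse_def)
  then show ?thesis
    using injD[OF inj_check] by blast
qed

proposition regular_set_fills_loops:
  assumes domain: "open \<Omega>" "convex \<Omega>"
    and invertible: "\<And>c. c \<in> \<Omega> \<Longrightarrow> \<exists>S. bounded_inverse (check.function_pencil c) S"
    and loop: "polynomial_function p" "pathfinish p = pathstart p" "path_image p \<subseteq> \<Omega> \<inter> regular_set"
    and winding: "z \<notin> path_image p" "winding_number p z \<noteq> 0"
  shows "z \<in> \<Omega> \<inter> regular_set"
proof -
  obtain S where S_inverse: "\<And>c. c \<in> \<Omega> \<Longrightarrow> bounded_inverse (check.function_pencil c) (S c)"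
    using invertible by metis
  have "z \<in> \<Omega>"
    using winding_number_zero_outside[of p \<Omega> z] loop winding domain(2)
    by (auto simp: path_polynomial_function)
  have "surj (pencil z)"
    using ex_pencil_preimage_inside_loop[OF domain S_inverse loop \<open>z \<in> \<Omega>\<close> winding] by (metis surjI)
  moreover have "inj (pencil z)"
  proof (rule injI)
    fix f g assume "pencil z f = pencil z g"
    moreover have "S z (check (pencil z f)) = check f" for f
      using S_inverse[OF \<open>z \<in> \<Omega>\<close>] check_in_check_alg by (simp add: check_pencil bounded_inverse_def)
    ultimately show "f = g"
      using injD[OF inj_check] by metis
  qed
  ultimately show ?thesis
    using \<open>z \<in> \<Omega>\<close> by (simp add: regular_set_def bij_def)
qed

corollary connected_Compl_regular_set:
  assumes "open \<Omega>" "convex \<Omega>" "bounded \<Omega>"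
    and "\<And>c. c \<in> \<Omega> \<Longrightarrow> \<exists>S. bounded_inverse (check.function_pencil c) S"
  shows "connected (- (\<Omega> \<inter> regular_set))"
  using assms regular_set_fills_loops[OF assms(1,2,4)] open_regular_set
  by (intro connected_Compl_if_loops_filled) auto

end

section \<open>Weighted automorphisms\<close>

locale weighted_automorphism = semisimple_banach_algebra +
  fixes U :: "'a \<Rightarrow> 'a" and w :: 'a
  assumes automorphism: "algebra_automorphism j U"
begin

definition T :: "'a \<Rightarrow> 'a" where
  "T f = w * U f"

abbreviation Tc :: "(('a \<Rightarrow> complex) \<Rightarrow> complex) \<Rightarrow> (('a \<Rightarrow> complex) \<Rightarrow> complex)" where
  "Tc \<equiv> check_op j w U"

lemma bounded_linear_T: "bounded_linear T"
  unfolding T_def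
  by (intro bounded_linear_const_mult bounded_linear_automorphism semisimple automorphism)

lemma check_T: "check (T f) = Tc (check f)"
  using shilov_chars shilov_comp_automorphism[OF automorphism]
  by (auto simp: fun_eq_iff check_def check_op_def T_def char_mult)

lemma linear_map_Tc: "linear_map Tc"
  by (auto simp: linear_map_def check_op_def algebra_simps)

lemma bounded_map_Tc: "bounded_map Tc"
  unfolding bounded_map_def
proof (intro conjI ballI exI)
  fix g assume g_in: "g \<in> check_alg j"
  have weight: "cmod (t w * c) \<le> norm w * b" if "t \<in> shilov" "cmod c \<le> b" for t c b
    using char_le_norm[OF shilov_chars[OF that(1)]] that(2) by (simp add: norm_mult mult_mono)
  show "Tc g \<in> check_alg j"
  proof (rule check_algI[where K = "norm w"])
    fix \<epsilon> :: real assume "\<epsilon> > 0"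
    then obtain f where f_approx: "\<And>t. t \<in> shilov \<Longrightarrow> cmod (g t - t f) < \<epsilon>"
      using check_alg_approx[OF g_in] by blast
    have "cmod (Tc g t - t (T f)) \<le> norm w * \<epsilon>" if t_shilov: "t \<in> shilov" for t
    proof -
      have "Tc g t - t (T f) = t w * (g (t \<circ> U) - (t \<circ> U) f)"
        using t_shilov shilov_chars[OF t_shilov]
        by (simp add: check_op_def T_def char_mult algebra_simps)
      then show ?thesis
        using weight[OF t_shilov less_imp_le]
          f_approx[OF shilov_comp_automorphism[OF automorphism t_shilov]] by simp
    qed
    then show "\<exists>f. \<forall>t\<in>shilov. cmod (Tc g t - t f) \<le> norm w * \<epsilon>"
      by blast
  qed (simp_all add: check_op_def)
  show "sup_norm (Tc g) \<le> norm w * sup_norm g"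
    using weight norm_le_sup_norm[OF g_in] shilov_comp_automorphism[OF automorphism]
    by (intro sup_norm_leI) (simp add: check_op_def)
qed

text \<open>The resolvent sets of \<open>T\<close> inside the unit disc, and outside of it after the change of
  variables \<open>c \<mapsto> inverse c\<close>, are those of the pencils \<open>T - c\<close> and \<open>1 - c T\<close>.\<close>

sublocale inner: restricted_pencil j T id Tc id
  by intro_locales
    (auto intro!: operator_pencil_axioms.intro function_pencil_axioms.intro
      restricted_pencil_axioms.intro bounded_linear_T bounded_linear_id linear_map_Tc
      linear_map_id bounded_map_id check_T)

sublocale outer: restricted_pencil j id T id Tc
  by intro_locales
    (auto intro!: operator_pencil_axioms.intro function_pencil_axioms.intro
      restricted_pencil_axioms.intro bounded_linear_T bounded_linear_id linear_map_Tc
      linear_map_id bounded_map_Tc check_T)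

lemma notin_check_spectrum_iff:
  "c \<notin> check_spectrum j Tc \<longleftrightarrow> (\<exists>S. bounded_inverse (inner.check.function_pencil c) S)"
  unfolding check_spectrum_def bounded_inverse_def bounded_map_def sup_norm_def
    inner.check.function_pencil_def Let_def by auto

lemma op_spectrum_eq: "op_spectrum j T = - inner.regular_set"
proof -
  have "c \<notin> op_spectrum j T \<longleftrightarrow> c \<in> inner.regular_set" for c
  proof
    assume "c \<notin> op_spectrum j T"
    then show "c \<in> inner.regular_set"
      unfolding op_spectrum_def inner.regular_set_def inner.pencil_def cscale_eq
      by (auto intro: o_bij simp: fun_eq_iff)
  next
    assume c_regular: "c \<in> inner.regular_set"
    obtain K where "\<And>x. norm (inner.resolvent c x) \<le> norm x * K"
      using bounded_linear.bounded[OF inner.bounded_linear_resolvent[OF c_regular]] by blast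
    then show "c \<notin> op_spectrum j T"
      using inner.pencil_resolvent[OF c_regular] inner.resolvent_pencil[OF c_regular]
      unfolding op_spectrum_def inner.pencil_def cscale_eq
      by (auto simp: mult.commute intro!: exI[of _ "inner.resolvent c"])
  qed
  then show ?thesis by blast
qed

lemma zero_in_outer_regular_set: "0 \<in> outer.regular_set"
proof -
  have "outer.pencil 0 = id"
    by (simp add: fun_eq_iff outer.pencil_def)
  then show ?thesis
    by (simp add: outer.regular_set_def)
qed

lemma outer_regular_set_iff:
  assumes "c \<noteq> 0"
  shows "c \<in> outer.regular_set \<longleftrightarrow> inverse c \<in> inner.regular_set"
proof -
  have "outer.pencil c = (\<lambda>x. emb (- c) * x) \<circ> inner.pencil (inverse c)"
    using emb_mult_inverse_cancel[OF assms]
    by (simp add: fun_eq_iff outer.pencil_def inner.pencil_def emb_minus algebra_simps)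
  moreover have "bij (\<lambda>x. emb (- c) * x)"
    using assms by (intro o_bij[of "\<lambda>x. emb (- inverse c) * x"])
      (auto simp: fun_eq_iff simp flip: mult.assoc emb_mult)
  ultimately show ?thesis
    using bij_betw_comp_iff2[of "\<lambda>x. emb (- c) * x" UNIV UNIV "inner.pencil (inverse c)" UNIV]
    by (simp add: outer.regular_set_def inner.regular_set_def)
qed

lemma outer_check_invertible:
  assumes "cmod c < 1" and notin: "\<And>c. cmod c > 1 \<Longrightarrow> c \<notin> check_spectrum j Tc"
  shows "\<exists>S. bounded_inverse (outer.check.function_pencil c) S"
proof (cases "c = 0")
  case True
  then have "bounded_inverse (outer.check.function_pencil c) id"
    by (simp add: bounded_inverse_def bounded_map_id outer.check.function_pencil_def)
  then show ?thesis
    by blast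
next
  case False
  then have "cmod (inverse c) > 1"
    using assms(1) by (simp add: norm_inverse one_less_inverse)
  then obtain S where "bounded_inverse (inner.check.function_pencil (inverse c)) S"
    using notin notin_check_spectrum_iff by blast
  moreover have "outer.check.function_pencil c =
      (\<lambda>g t. - c * inner.check.function_pencil (inverse c) g t)"
    using False
    by (simp add: fun_eq_iff outer.check.function_pencil_def inner.check.function_pencil_def
        algebra_simps)
  ultimately show ?thesis
    using bounded_inverse_scale[of "inner.check.function_pencil (inverse c)" S "- c"] False by auto
qed

lemma connected_op_spectrum_Un_Compl_disc:
  assumes "\<And>c. cmod c < 1 \<Longrightarrow> c \<notin> check_spectrum j Tc"
  shows "connected (op_spectrum j T \<union> - ball 0 1)"
proof -
  have "connected (- (ball 0 1 \<inter> inner.regular_set))"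
    using assms notin_check_spectrum_iff by (intro inner.connected_Compl_regular_set) auto
  then show ?thesis
    by (simp add: op_spectrum_eq Un_commute)
qed

lemma connected_inverse_op_spectrum_Un_Compl_disc:
  assumes "\<And>c. cmod c > 1 \<Longrightarrow> c \<notin> check_spectrum j Tc"
  shows "connected ({c. c \<noteq> 0 \<and> inverse c \<in> op_spectrum j T} \<union> - ball 0 1)"
proof -
  have "connected (- (ball 0 1 \<inter> outer.regular_set))"
    using assms outer_check_invertible by (intro outer.connected_Compl_regular_set) auto
  moreover have "c \<in> - outer.regular_set \<longleftrightarrow> c \<noteq> 0 \<and> inverse c \<in> op_spectrum j T" for c
    using zero_in_outer_regular_set outer_regular_set_iff[of c]
    by (cases "c = 0") (auto simp: op_spectrum_eq)
  then have "{c. c \<noteq> 0 \<and> inverse c \<in> op_spectrum j T} = - outer.regular_set"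
    by blast
  ultimately show ?thesis
    by (simp add: Un_commute)
qed

end

theorem theorem4:
  fixes j :: "'a::{real_normed_algebra_1,comm_ring_1,banach}"
    and U :: "'a \<Rightarrow> 'a" and w :: 'a
  assumes "complex_structure j"
    and "semisimple TYPE('a)"
    and "algebra_automorphism j U"
    and "\<exists>v. w * v = 1"
    and "check_spectrum j (check_op j w U) = sphere 0 1"
    and "sphere 0 1 \<subseteq> op_spectrum j (\<lambda>f. w * U f)"
  shows "connected (op_spectrum j (\<lambda>f. w * U f))"
proof -
  interpret weighted_automorphism j U w
    using assms by unfold_locales
  have T_eq: "(\<lambda>f. w * U f) = T"
    by (simp add: T_def[abs_def])
  show ?thesis
    unfolding T_eq
  proof (rule connected_if_connected_Un_Compl_disc)
    show "sphere 0 1 \<subseteq> op_spectrum j T"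
      using assms(6) by (simp add: T_eq)
    show "connected (op_spectrum j T \<union> - ball 0 1)"
      using assms(5) by (intro connected_op_spectrum_Un_Compl_disc) simp
    show "connected ({c. c \<noteq> 0 \<and> inverse c \<in> op_spectrum j T} \<union> - ball 0 1)"
      using assms(5) by (intro connected_inverse_op_spectrum_Un_Compl_disc) simp
  qed
qed

end
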